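(* For every $d\ge1$, the sets $\mathcal{S}\Sigma_{2d}$ and $\mathcal{S}\mathcal{P}_{2d}$ are full-dimensional pointed closed convex cones in $\mathbb{R}^{\pi(2d)}$, and $$\mathcal{S}\Sigma_{2d}=\lim_{n\to\infty}\Sigma_{n,2d}^{\mathcal{S}},\qquad \mathcal{S}\mathcal{P}_{2d}=\lim_{n\to\infty}\mathcal{P}_{n,2d}^{\mathcal{S}}$$ are the Kuratowski limits.
   Context: Let $\Lambda_{2d}$ be the set of partitions of $2d$ and $\pi(2d)=|\Lambda_{2d}|$. For a partition $\lambda$, $p_\lambda=\prod_i p_{\lambda_i}$ with $p_r=X_1^r+\cdots+X_n^r$. For $n\ge2d$ the $p_\lambda$, $\lambda\in\Lambda_{2d}$, form a basis of the space of symmetric forms of degree $2d$ in $n$ variables, and via this basis these spaces are identified with $\mathbb{R}^{\pi(2d)}=\mathbb{R}^{\Lambda_{2d}}$ for all $n\ge 2d$. For $n\ge2d$, $\Sigma_{n,2d}^{\mathcal{S}}\subset\mathbb{R}^{\pi(2d)}$ (respectively $\mathcal{P}_{n,2d}^{\mathcal{S}}$) is the set of $c$ such that $\sum_\lambda c_\lambda p_\lambda(X_1,\dots,X_n)$ is a sum of squares of real polynomials (respectively is nonnegative on $\mathbb{R}^n$). Set $\mathcal{S}\Sigma_{2d}=\bigcap_{n\ge2d}\Sigma_{n,2d}^{\mathcal{S}}$ and $\mathcal{S}\mathcal{P}_{2d}=\bigcap_{n\ge2d}\mathcal{P}_{n,2d}^{\mathcal{S}}$. A sequence of sets $A_n\subset\mathbb{R}^N$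 has Kuratowski limit $A$ if $A=\liminf_nA_n=\limsup_nA_n$, where $\liminf_nA_n$ is the set of limits of convergent sequences $(a_n)$ with $a_n\in A_n$ for all large $n$, and $\limsup_nA_n$ is the set of limits of convergent sequences $(a_{n_k})_k$ with $a_{n_k}\in A_{n_k}$ for some $n_1<n_2<\cdots$. A convex cone is pointed if it contains no line. *)

theory Defs
  imports
    "HOL-Analysis.Analysis"
    "HOL-Library.Multiset"
    "HOL-Library.Poly_Mapping"
    "HOL-Library.Function_Algebras"
begin

text \<open>
  The dimension \<open>\<pi>(2d)\<close> depends on \<open>d\<close>, so the coefficient space is a subspace of the space of
  all functions from multisets to the reals.  HOL-Analysis provides the product topology on
  functions; the pointwise vector space structure is added here.
\<close>

instantiation "fun" :: (type, real_vector) real_vector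
begin

definition scaleR_fun :: "real \<Rightarrow> ('a \<Rightarrow> 'b) \<Rightarrow> 'a \<Rightarrow> 'b"
  where "scaleR_fun r f = (\<lambda>x. r *\<^sub>R f x)"

instance
  by standard (auto simp: scaleR_fun_def fun_eq_iff scaleR_add_right scaleR_add_left)

end

definition partitions_of :: "nat \<Rightarrow> nat multiset set"
  where "partitions_of m = {L. 0 \<notin># L \<and> sum_mset L = m}"

text \<open>
  The space \<open>\<real>\<^bsup>\<Lambda>\<^esup>\<close> for \<open>\<Lambda> = partitions_of (2 * d)\<close>, a function on \<open>\<Lambda>\<close> being extended by zero.
  As \<open>\<Lambda>\<close> is finite, the subspace topology is the Euclidean one.
\<close>
definition coeff_space :: "nat \<Rightarrow> (nat multiset \<Rightarrow> real) set"
  where "coeff_space d = {c. \<forall>L. L \<notin> partitions_of (2 * d) \<longrightarrow> c L = 0}"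

text \<open>
  Real polynomials in the variables \<open>X\<^sub>0, X\<^sub>1, \<dots>\<close>: finitely supported functions from exponent
  vectors to coefficients, multiplied by convolution.
\<close>
type_synonym real_mpoly = "(nat \<Rightarrow>\<^sub>0 nat) \<Rightarrow>\<^sub>0 real"

definition mpoly_const :: "real \<Rightarrow> real_mpoly"
  where "mpoly_const a = Poly_Mapping.single 0 a"

definition mpoly_var :: "nat \<Rightarrow> real_mpoly"
  where "mpoly_var i = Poly_Mapping.single (Poly_Mapping.single i 1) 1"

definition mpolys :: "nat \<Rightarrow> real_mpoly set"
  where "mpolys n = {q. \<forall>m \<in> Poly_Mapping.keys q. Poly_Mapping.keys m \<subseteq> {..<n}}"

definition mpoly_eval :: "(nat \<Rightarrow> real) \<Rightarrow> real_mpoly \<Rightarrow> real"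
  where "mpoly_eval x q =
    (\<Sum>m\<in>Poly_Mapping.keys q. Poly_Mapping.lookup q m *
       (\<Prod>i\<in>Poly_Mapping.keys m. x i ^ Poly_Mapping.lookup m i))"

text \<open>The variables \<open>X\<^sub>1, \<dots>, X\<^sub>n\<close> of the mathematical text are numbered from \<open>0\<close> to \<open>n - 1\<close>.\<close>
definition power_sum :: "nat \<Rightarrow> nat \<Rightarrow> real_mpoly"
  where "power_sum n r = (\<Sum>i<n. mpoly_var i ^ r)"

definition power_sum_part :: "nat \<Rightarrow> nat multiset \<Rightarrow> real_mpoly"
  where "power_sum_part n L = (\<Prod>r\<in>#L. power_sum n r)"

definition sym_form :: "nat \<Rightarrow> nat \<Rightarrow> (nat multiset \<Rightarrow> real) \<Rightarrow> real_mpoly"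
  where "sym_form n d c = (\<Sum>L\<in>partitions_of (2 * d). mpoly_const (c L) * power_sum_part n L)"

definition sum_of_squares :: "nat \<Rightarrow> real_mpoly \<Rightarrow> bool"
  where "sum_of_squares n f \<longleftrightarrow> (\<exists>qs. set qs \<subseteq> mpolys n \<and> f = (\<Sum>q\<leftarrow>qs. q ^ 2))"

definition Sigma_sym :: "nat \<Rightarrow> nat \<Rightarrow> (nat multiset \<Rightarrow> real) set"
  where "Sigma_sym n d = {c \<in> coeff_space d. sum_of_squares n (sym_form n d c)}"

text \<open>
  A point of \<open>\<real>\<^sup>n\<close> is given by the first \<open>n\<close> values of \<open>x\<close>; the others do not occur in
  \<open>sym_form n d c\<close>.
\<close>
definition P_sym :: "nat \<Rightarrow> nat \<Rightarrow> (nat multiset \<Rightarrow> real) set"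
  where "P_sym n d = {c \<in> coeff_space d. \<forall>x. 0 \<le> mpoly_eval x (sym_form n d c)}"

definition S_Sigma :: "nat \<Rightarrow> (nat multiset \<Rightarrow> real) set"
  where "S_Sigma d = (\<Inter>n\<in>{2 * d..}. Sigma_sym n d)"

definition S_P :: "nat \<Rightarrow> (nat multiset \<Rightarrow> real) set"
  where "S_P d = (\<Inter>n\<in>{2 * d..}. P_sym n d)"

text \<open>
  The limits below do not depend on finitely many members of the sequence, so it is harmless
  that \<open>Sigma_sym n d\<close> and \<open>P_sym n d\<close> are also defined for \<open>n < 2 * d\<close>.
\<close>
definition kuratowski_liminf :: "(nat \<Rightarrow> 'a::topological_space set) \<Rightarrow> 'a set"
  where "kuratowski_liminf A = {a. \<exists>s. (\<forall>\<^sub>F n in sequentially. s n \<in> A n) \<and> s \<longlonglongrightarrow> a}"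

definition kuratowski_limsup :: "(nat \<Rightarrow> 'a::topological_space set) \<Rightarrow> 'a set"
  where "kuratowski_limsup A =
    {a. \<exists>r s. strict_mono (r :: nat \<Rightarrow> nat) \<and> (\<forall>k. s k \<in> A (r k)) \<and> s \<longlonglongrightarrow> a}"

definition kuratowski_limit :: "(nat \<Rightarrow> 'a::topological_space set) \<Rightarrow> 'a set \<Rightarrow> bool"
  where "kuratowski_limit A S \<longleftrightarrow> S = kuratowski_liminf A \<and> S = kuratowski_limsup A"

definition pointed :: "'a::real_vector set \<Rightarrow> bool"
  where "pointed S \<longleftrightarrow> \<not> (\<exists>a v. v \<noteq> 0 \<and> range (\<lambda>t::real. a + t *\<^sub>R v) \<subseteq> S)"

definition full_dimensional_in :: "'a::topological_space set \<Rightarrow> 'a set \<Rightarrow> bool"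
  where "full_dimensional_in V S \<longleftrightarrow> (top_of_set V) interior_of S \<noteq> {}"

lemma size_le_sum_mset: "0 \<notin># L \<Longrightarrow> size L \<le> sum_mset (L :: nat multiset)"
  by (induction L) auto

lemma finite_partitions_of: "finite (partitions_of m)"
proof (rule finite_subset)
  show "partitions_of m \<subseteq> mset ` {xs. set xs \<subseteq> {..m} \<and> length xs \<le> m}"
  proof
    fix L assume "L \<in> partitions_of m"
    then have L: "0 \<notin># L" "sum_mset L = m"
      by (auto simp: partitions_of_def)
    obtain xs where xs: "mset xs = L"
      using ex_mset by blast
    have "set xs \<subseteq> {..m}"
    proof
      fix x assume "x \<in> set xs"
      with xs have "x \<in># L" by auto
      then obtain M where "L = add_mset x M"
        by (blast dest: multi_member_split)
      with L(2) show "x \<in> {..m}" by simp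
    qed
    moreover have "length xs \<le> m"
      using size_le_sum_mset[OF L(1)] L(2) xs by (metis size_mset)
    ultimately show "L \<in> mset ` {xs. set xs \<subseteq> {..m} \<and> length xs \<le> m}"
      using xs by blast
  qed
  show "finite (mset ` {xs. set xs \<subseteq> {..m} \<and> length xs \<le> m})"
    by (intro finite_imageI finite_lists_length_le) simp
qed

end

theory Submission
  imports Defs "HOL-Computational_Algebra.Polynomial"
begin

text \<open>
  Setting variables to zero shows that both sequences of cones decrease, so their Kuratowski
  limits are the intersections as soon as every member is closed.

  Closedness of the sums of squares: if \<open>q\<^sup>2 \<le> f\<close> with \<open>f\<close> homogeneous of degree \<open>2d\<close>, then
  \<open>q\<close> has degree at most \<open>d\<close>.  Diagonalising the Gram matrix bounds the number of squares, the
  coefficients of the \<open>q\<close> are bounded by finitely many values of \<open>f\<close>, and a convergent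
  subsequence of the coefficients represents the limit.

  Interior: every \<open>p\<^sub>L\<close> is an inner product of two vectors of forms of degree \<open>d\<close>, so by
  Cauchy-Schwarz it is dominated by a sum of squares whose coefficients in the power sum basis do
  not depend on \<open>n\<close>; the sum of these dominating forms is an interior point.  Pointedness is the
  linear independence of the \<open>p\<^sub>L\<close> in \<open>2d\<close> variables.
\<close>

subsection \<open>Limits of sums of squares in a finite-dimensional function space\<close>

text \<open>Induction on \<open>A\<close> in the style of Gram-Schmidt, with finite combinations of
  point evaluations as functionals. Independence yields a point that separates the new function from
  the old ones. Coefficients in the span of \<open>g\<close> can thus be read off from finitely many
  values.\<close>

lemma dual_functionals:
  fixes g :: "'a \<Rightarrow> 'x \<Rightarrow> real"
  assumes "finite A"
    and "\<And>c a. (\<And>x. (\<Sum>b\<in>A. c b * g b x) = 0) \<Longrightarrow> a \<in> A \<Longrightarrow> c a = 0"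
  shows "\<exists>X w. finite X \<and> (\<forall>a\<in>A. \<forall>b\<in>A. (\<Sum>x\<in>X. w b x * g a x) = (if a = b then 1 else 0))"
  using assms
proof (induction A)
  case empty
  show ?case by auto
next
  case (insert k A)
  have "c a = 0" if "\<And>x. (\<Sum>b\<in>A. c b * g b x) = 0" "a \<in> A" for c a
  proof -
    have "(\<Sum>b\<in>insert k A. (c(k := 0)) b * g b x) = 0" for x
    proof -
      have "(\<Sum>b\<in>A. (c(k := 0)) b * g b x) = (\<Sum>b\<in>A. c b * g b x)"
        using insert.hyps by (intro sum.cong) auto
      thus ?thesis using that(1)[of x] insert.hyps by simp
    qed
    from insert.prems[OF this, of a] that(2) insert.hyps show ?thesis by (auto split: if_splits)
  qed
  hence "\<exists>X w. finite X \<and> (\<forall>a\<in>A. \<forall>b\<in>A. (\<Sum>x\<in>X. w b x * g a x) = (if a = b then 1 else 0))"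
    by (rule insert.IH)
  then obtain X w where X: "finite X"
    and w: "\<And>a b. a \<in> A \<Longrightarrow> b \<in> A \<Longrightarrow> (\<Sum>x\<in>X. w b x * g a x) = (if a = b then 1 else 0)"
    by blast
  define W where "W b f = (\<Sum>x\<in>X. w b x * f x)" for b and f :: "'x \<Rightarrow> real"
  \<comment> \<open>The part of \<open>g k\<close> that the old functionals do not see; it is a
    combination of the \<open>g b\<close> in which \<open>g k\<close> has coefficient 1, so it
    cannot vanish identically.\<close>
  define h where "h x = g k x - (\<Sum>b\<in>A. W b (g k) * g b x)" for x
  have "\<exists>x. h x \<noteq> 0"
  proof (rule ccontr)
    assume neg: "\<not> ?thesis"
    define c where "c a = (if a = k then 1 else - W a (g k))" for a
    have "(\<Sum>b\<in>insert k A. c b * g b x) = h x" for x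
    proof -
      have "(\<Sum>b\<in>A. c b * g b x) = (\<Sum>b\<in>A. - (W b (g k) * g b x))"
        using insert.hyps by (intro sum.cong) (auto simp: c_def)
      thus ?thesis using insert.hyps by (simp add: h_def c_def sum_negf)
    qed
    with neg have "c k = 0" by (intro insert.prems[of c k]) auto
    thus False by (simp add: c_def)
  qed
  then obtain z where z: "h z \<noteq> 0" by blast
  \<comment> \<open>Truncated to \<open>X\<close>, so that adding the point \<open>z\<close>, which
    may lie outside \<open>X\<close>, does not change the old functionals.\<close>
  define w0 where "w0 b x = (if x \<in> X then w b x else 0)" for b x
  \<comment> \<open>Evaluation at \<open>z\<close>, corrected by the old functionals so that it
    annihilates the old functions, and scaled to be 1 on \<open>g k\<close>.\<close>
  define v where "v x = ((if x = z then 1 else 0) - (\<Sum>b\<in>A. g b z * w0 b x)) / h z" for x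
  let ?X = "insert z X"
  have w0: "(\<Sum>x\<in>?X. w0 b x * f x) = W b f" for b f
    unfolding W_def using X by (intro sum.mono_neutral_cong_right) (auto simp: w0_def)
  have v: "(\<Sum>x\<in>?X. v x * f x) = (f z - (\<Sum>b\<in>A. g b z * W b f)) / h z" for f
  proof -
    have "v x * f x = ((if x = z then f x else 0) - (\<Sum>b\<in>A. g b z * (w0 b x * f x))) / h z" for x
      by (cases "x = z") (simp_all add: v_def left_diff_distrib sum_distrib_right mult.assoc)
    hence "(\<Sum>x\<in>?X. v x * f x) = ((\<Sum>x\<in>?X. if x = z then f x else 0)
        - (\<Sum>x\<in>?X. \<Sum>b\<in>A. g b z * (w0 b x * f x))) / h z"
      by (simp only: sum_subtractf[symmetric] sum_divide_distrib)
    also have "(\<Sum>x\<in>?X. \<Sum>b\<in>A. g b z * (w0 b x * f x)) = (\<Sum>b\<in>A. g b z * W b f)"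
      by (subst sum.swap) (simp only: sum_distrib_left[symmetric] w0)
    finally show ?thesis using X by simp
  qed
  have W_delta: "W b (g a) = (if a = b then 1 else 0)" if "a \<in> A" "b \<in> A" for a b
    using w[OF that] by (simp add: W_def)
  have v_A: "(\<Sum>x\<in>?X. v x * g a x) = 0" if "a \<in> A" for a
  proof -
    have "(\<Sum>b\<in>A. g b z * W b (g a)) = (\<Sum>b\<in>A. if b = a then g b z else 0)"
      using that by (intro sum.cong) (auto simp: W_delta)
    thus ?thesis using that insert.hyps by (simp add: v)
  qed
  have v_k: "(\<Sum>x\<in>?X. v x * g k x) = 1"
    using z by (simp add: v h_def mult.commute)
  \<comment> \<open>Subtracting a multiple of \<open>v\<close> makes the old functionals vanish on
    \<open>g k\<close> and leaves their values on the old functions alone.\<close>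
  define w' where "w' b x = (if b = k then v x else w0 b x - W b (g k) * v x)" for b x
  have w': "(\<Sum>x\<in>?X. w' b x * f x) =
      (if b = k then \<Sum>x\<in>?X. v x * f x else W b f - W b (g k) * (\<Sum>x\<in>?X. v x * f x))" for b f
  proof (cases "b = k")
    case False
    hence "(\<Sum>x\<in>?X. w' b x * f x) = (\<Sum>x\<in>?X. w0 b x * f x - W b (g k) * (v x * f x))"
      by (intro sum.cong) (auto simp: w'_def algebra_simps)
    thus ?thesis using False by (simp only: sum_subtractf sum_distrib_left[symmetric] w0 if_False)
  qed (simp add: w'_def)
  have "(\<Sum>x\<in>?X. w' b x * g a x) = (if a = b then 1 else 0)"
    if "a \<in> insert k A" "b \<in> insert k A" for a b
    unfolding w' using that insert.hyps by (auto simp: v_A v_k W_delta simp del: sum.insert)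
  with X show ?case by (intro exI[of _ ?X] exI[of _ w']) auto
qed

text \<open>Lagrange diagonalisation: completing the square in the variable \<open>y k\<close>
  splits off one square, and the remaining form in fewer variables is again nonnegative.\<close>

lemma psd_sum_of_squares:
  fixes G :: "'a \<Rightarrow> 'a \<Rightarrow> real"
  assumes "finite A" "\<And>a b. G a b = G b a"
    and "\<And>y. 0 \<le> (\<Sum>a\<in>A. \<Sum>b\<in>A. G a b * y a * y b)"
  shows "\<exists>L. \<forall>y. (\<Sum>a\<in>A. \<Sum>b\<in>A. G a b * y a * y b) = (\<Sum>c\<in>A. (\<Sum>a\<in>A. L c a * y a)\<^sup>2)"
  using assms
proof (induction A arbitrary: G)
  case empty
  show ?case by simp
next
  case (insert k A)
  note sym = insert.prems(1)
  define s where "s y = (\<Sum>b\<in>A. G k b * y b)" for y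
  define Q where "Q y = (\<Sum>a\<in>insert k A. \<Sum>b\<in>insert k A. G a b * y a * y b)" for y
  define R where "R y = (\<Sum>a\<in>A. \<Sum>b\<in>A. G a b * y a * y b)" for y
  have Q_nonneg: "0 \<le> Q y" for y using insert.prems(2) by (simp add: Q_def)
  have Q: "Q y = G k k * (y k)\<^sup>2 + 2 * y k * s y + R y" for y
  proof -
    have "(\<Sum>a\<in>A. \<Sum>b\<in>insert k A. G a b * y a * y b) = y k * s y + R y"
      using insert.hyps sym[of _ k] by (simp add: R_def s_def sum_distrib_left sum.distrib mult_ac)
    moreover have "(\<Sum>b\<in>insert k A. G k b * y k * y b) = G k k * (y k)\<^sup>2 + y k * s y"
      using insert.hyps by (simp add: s_def sum_distrib_left power2_eq_square mult_ac)
    ultimately show ?thesis using insert.hyps by (simp add: Q_def)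
  qed
  have upd: "s (y(k := t)) = s y" "R (y(k := t)) = R y" for y t
    unfolding s_def R_def using insert.hyps by (auto intro!: sum.cong)
  have Qt: "0 \<le> G k k * t\<^sup>2 + 2 * t * s y + R y" for t y
    using Q_nonneg[of "y(k := t)"] by (simp add: Q upd)
  have Gkk: "0 \<le> G k k"
    using Qt[of 1 "\<lambda>_. 0"] by (simp add: s_def R_def)
  \<comment> \<open>With a zero diagonal entry the form is affine in \<open>y k\<close> with slope
    \<open>2 * s y\<close>; a nonzero slope would allow the value -1.\<close>
  have s0: "s y = 0" if "G k k = 0" for y
  proof (rule ccontr)
    assume "s y \<noteq> 0"
    thus False using Qt[of "- (R y + 1) / (2 * s y)" y] that by (simp add: field_simps)
  qed
  \<comment> \<open>The Schur complement of the entry \<open>G k k\<close>. If this entry is 0,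
    division by zero gives 0 and \<open>H\<close> is just \<open>G\<close>.\<close>
  define H where "H a b = G a b - G k a * G k b / G k k" for a b
  have H: "(\<Sum>a\<in>A. \<Sum>b\<in>A. H a b * y a * y b) = R y - (s y)\<^sup>2 / G k k" for y
    unfolding H_def R_def s_def power2_eq_square sum_product sum_divide_distrib sum_subtractf[symmetric]
    by (intro sum.cong) (auto simp: algebra_simps)
  have decomp: "Q y = (G k k * y k + s y)\<^sup>2 / G k k + (\<Sum>a\<in>A. \<Sum>b\<in>A. H a b * y a * y b)" for y
    using s0[of y] unfolding H Q
    by (cases "G k k = 0") (auto simp: field_simps power2_eq_square)
  \<comment> \<open>For \<open>G k k > 0\<close> the value of the form of \<open>H\<close> is the
    minimum of the original form over \<open>y k\<close>, attained at
    \<open>- s y / G k k\<close>.\<close>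
  have H_nonneg: "0 \<le> (\<Sum>a\<in>A. \<Sum>b\<in>A. H a b * y a * y b)" for y
    using Qt[of "- s y / G k k" y] s0[of y] unfolding H
    by (cases "G k k = 0") (auto simp: field_simps power2_eq_square)
  from insert.IH[of H, OF _ H_nonneg] sym obtain L where
    L: "\<And>y. (\<Sum>a\<in>A. \<Sum>b\<in>A. H a b * y a * y b) = (\<Sum>c\<in>A. (\<Sum>a\<in>A. L c a * y a)\<^sup>2)"
    by (auto simp: H_def mult.commute)
  define L' where "L' c a = (if c = k then G k a / sqrt (G k k) else if a = k then 0 else L c a)" for c a
  have "Q y = (\<Sum>c\<in>insert k A. (\<Sum>a\<in>insert k A. L' c a * y a)\<^sup>2)" for y
  proof -
    have "(\<Sum>a\<in>insert k A. L' k a * y a) = (G k k * y k + s y) / sqrt (G k k)"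
      using insert.hyps by (simp add: L'_def s_def sum_divide_distrib add_divide_distrib)
    hence "(\<Sum>a\<in>insert k A. L' k a * y a)\<^sup>2 = (G k k * y k + s y)\<^sup>2 / G k k"
      using Gkk by (simp add: power_divide)
    moreover have "(\<Sum>a\<in>insert k A. L' c a * y a) = (\<Sum>a\<in>A. L c a * y a)" if "c \<in> A" for c
      using that insert.hyps by (auto simp: L'_def intro!: sum.cong)
    ultimately show ?thesis using insert.hyps by (simp add: decomp L)
  qed
  thus ?case unfolding Q_def by blast
qed

text \<open>The Gram matrix of the coefficient vectors is positive semidefinite, and diagonalising
  it leaves one square per element of \<open>A\<close>. The number of squares no longer depends on
  the list, as a compactness argument requires.\<close>

lemma sum_list_of_squares_card:
  fixes qs :: "('a \<Rightarrow> real) list"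
  assumes "finite A"
  shows "\<exists>L. \<forall>y. (\<Sum>q\<leftarrow>qs. (\<Sum>a\<in>A. q a * y a)\<^sup>2) = (\<Sum>c\<in>A. (\<Sum>a\<in>A. L c a * y a)\<^sup>2)"
proof -
  define G where "G a b = (\<Sum>q\<leftarrow>qs. q a * q b)" for a b
  have eq: "(\<Sum>q\<leftarrow>qs. (\<Sum>a\<in>A. q a * y a)\<^sup>2) = (\<Sum>a\<in>A. \<Sum>b\<in>A. G a b * y a * y b)" for y
    unfolding G_def
  proof (induction qs)
    case (Cons q qs)
    have "(\<Sum>a\<in>A. q a * y a)\<^sup>2 = (\<Sum>a\<in>A. \<Sum>b\<in>A. q a * q b * y a * y b)"
      by (simp add: power2_eq_square sum_product mult_ac)
    thus ?case using Cons.IH by (simp add: distrib_right sum.distrib)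
  qed simp
  have "\<exists>L. \<forall>y. (\<Sum>a\<in>A. \<Sum>b\<in>A. G a b * y a * y b) = (\<Sum>c\<in>A. (\<Sum>a\<in>A. L c a * y a)\<^sup>2)"
  proof (rule psd_sum_of_squares[OF assms])
    show "G a b = G b a" for a b by (simp add: G_def mult.commute)
    show "0 \<le> (\<Sum>a\<in>A. \<Sum>b\<in>A. G a b * y a * y b)" for y
      unfolding eq[symmetric] by (intro sum_list_nonneg) auto
  qed
  thus ?thesis unfolding eq .
qed

text \<open>Bolzano-Weierstrass for one index at a time, each time refining the subsequence already
  chosen.\<close>

lemma finite_family_convergent_subsequence:
  fixes u :: "nat \<Rightarrow> 'i \<Rightarrow> 'a::heine_borel"
  assumes "finite I" "\<And>i. i \<in> I \<Longrightarrow> bounded (range (\<lambda>k. u k i))"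
  shows "\<exists>r l. strict_mono (r :: nat \<Rightarrow> nat) \<and> (\<forall>i\<in>I. (\<lambda>k. u (r k) i) \<longlonglongrightarrow> l i)"
  using assms
proof (induction I)
  case empty
  show ?case using strict_mono_id by auto
next
  case (insert j I)
  then obtain r l where r: "strict_mono r" and l: "\<And>i. i \<in> I \<Longrightarrow> (\<lambda>k. u (r k) i) \<longlonglongrightarrow> l i"
    by auto
  have "bounded (range (\<lambda>k. u (r k) j))"
    by (rule bounded_subset[OF insert.prems[of j]]) auto
  from bounded_imp_convergent_subsequence[OF this] obtain t m
    where t: "strict_mono t" and m: "(\<lambda>k. u (r (t k)) j) \<longlonglongrightarrow> m"
    by (auto simp: o_def)
  have "(\<lambda>k. u (r (t k)) i) \<longlonglongrightarrow> (l(j := m)) i" if "i \<in> insert j I" for i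
    using that m LIMSEQ_subseq_LIMSEQ[OF l t] insert.hyps by (auto simp: o_def)
  moreover have "strict_mono (\<lambda>k. r (t k))"
    using strict_mono_o[OF r t] by (simp add: o_def)
  ultimately show ?case by (intro exI[of _ "\<lambda>k. r (t k)"] exI[of _ "l(j := m)"]) auto
qed

text \<open>With the number of squares fixed, each coefficient is a combination of values of one
  \<open>q\<close>, and \<open>q\<close> squared is at most the whole sum. Convergence bounds these
  values uniformly in \<open>k\<close>, so the coefficients converge along a subsequence and their
  limits represent \<open>F\<close>.\<close>

lemma limit_of_sums_of_squares:
  fixes g :: "'a \<Rightarrow> 'x \<Rightarrow> real" and qs :: "nat \<Rightarrow> ('a \<Rightarrow> real) list"
  assumes "finite A"
    and indep: "\<And>c a. (\<And>x. (\<Sum>b\<in>A. c b * g b x) = 0) \<Longrightarrow> a \<in> A \<Longrightarrow> c a = 0"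
    and lim: "\<And>x. (\<lambda>k. \<Sum>q\<leftarrow>qs k. (\<Sum>a\<in>A. q a * g a x)\<^sup>2) \<longlonglongrightarrow> F x"
  shows "\<exists>L. \<forall>x. F x = (\<Sum>c\<in>A. (\<Sum>a\<in>A. L c a * g a x)\<^sup>2)"
proof -
  define f where "f k x = (\<Sum>q\<leftarrow>qs k. (\<Sum>a\<in>A. q a * g a x)\<^sup>2)" for k x
  have "\<forall>k. \<exists>L. \<forall>x. f k x = (\<Sum>c\<in>A. (\<Sum>a\<in>A. L c a * g a x)\<^sup>2)"
    unfolding f_def using sum_list_of_squares_card[OF assms(1)] by metis
  then obtain L where L: "\<And>k x. f k x = (\<Sum>c\<in>A. (\<Sum>a\<in>A. L k c a * g a x)\<^sup>2)"
    by metis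
  from indep
  have "\<exists>X w. finite X \<and> (\<forall>a\<in>A. \<forall>b\<in>A. (\<Sum>x\<in>X. w b x * g a x) = (if a = b then 1 else 0))"
    by (rule dual_functionals[OF assms(1)])
  then obtain X w where X: "finite X"
    and w: "\<And>a b. a \<in> A \<Longrightarrow> b \<in> A \<Longrightarrow> (\<Sum>x\<in>X. w b x * g a x) = (if a = b then 1 else 0)"
    by blast
  have "\<exists>B. \<forall>k. norm (f k x) \<le> B" for x
    using convergent_imp_Bseq[OF convergentI[OF lim[of x]]] unfolding Bseq_def f_def by blast
  then obtain B where B: "\<And>k x. norm (f k x) \<le> B x" by metis
  have bound: "\<bar>L k c b\<bar> \<le> (\<Sum>x\<in>X. \<bar>w b x\<bar> * (1 + B x))" if "c \<in> A" "b \<in> A" for k c b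
  proof -
    define q where "q x = (\<Sum>a\<in>A. L k c a * g a x)" for x
    have "(\<Sum>x\<in>X. w b x * q x) = (\<Sum>a\<in>A. L k c a * (\<Sum>x\<in>X. w b x * g a x))"
      unfolding q_def sum_distrib_left by (subst sum.swap) (simp add: mult_ac)
    also have "\<dots> = (\<Sum>a\<in>A. if a = b then L k c a else 0)"
      using that by (intro sum.cong) (auto simp: w)
    also have "\<dots> = L k c b" using that assms(1) by simp
    finally have "\<bar>L k c b\<bar> = \<bar>\<Sum>x\<in>X. w b x * q x\<bar>" by simp
    also have "\<dots> \<le> (\<Sum>x\<in>X. \<bar>w b x\<bar> * (1 + B x))"
    proof (rule order.trans[OF sum_abs], intro sum_mono)
      fix x
      have "(q x)\<^sup>2 \<le> f k x"
        unfolding L q_def by (rule member_le_sum) (use that assms(1) in auto)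
      also have "\<dots> \<le> B x" using B[of k x] by simp
      finally have "(q x)\<^sup>2 \<le> B x" .
      \<comment> \<open>Follows from expanding
        \<open>(\<bar>q x\<bar> - 1)\<^sup>2 + (q x)\<^sup>2 \<ge> 0\<close>; it turns the bound on
        the square into one on \<open>q x\<close>.\<close>
      moreover have "\<bar>q x\<bar> \<le> 1 + (q x)\<^sup>2"
        using sum_squares_ge_zero[of "\<bar>q x\<bar> - 1" "q x"]
        by (simp add: power2_eq_square algebra_simps abs_if split: if_splits)
      ultimately have "\<bar>q x\<bar> \<le> 1 + B x" by simp
      thus "\<bar>w b x * q x\<bar> \<le> \<bar>w b x\<bar> * (1 + B x)"
        by (simp add: abs_mult mult_left_mono)
    qed
    finally show ?thesis .
  qed
  have "bounded (range (\<lambda>k. case_prod (L k) i))" if "i \<in> A \<times> A" for i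
  proof (cases i)
    case (Pair c b)
    thus ?thesis using that bound[of c b] unfolding bounded_iff by auto
  qed
  then obtain r l where r: "strict_mono (r :: nat \<Rightarrow> nat)"
    and l': "\<forall>i\<in>A \<times> A. (\<lambda>k. case_prod (L (r k)) i) \<longlonglongrightarrow> l i"
    using finite_family_convergent_subsequence[of "A \<times> A" "\<lambda>k. case_prod (L k)"] assms(1)
    by auto
  have l: "(\<lambda>k. L (r k) c b) \<longlonglongrightarrow> l (c, b)" if "c \<in> A" "b \<in> A" for c b
    using bspec[OF l', of "(c, b)"] that by simp
  have "F x = (\<Sum>c\<in>A. (\<Sum>a\<in>A. l (c, a) * g a x)\<^sup>2)" for x
  proof (rule LIMSEQ_unique)
    show "(\<lambda>k. f (r k) x) \<longlonglongrightarrow> F x"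
      using LIMSEQ_subseq_LIMSEQ[OF lim r] by (simp add: f_def o_def)
    show "(\<lambda>k. f (r k) x) \<longlonglongrightarrow> (\<Sum>c\<in>A. (\<Sum>a\<in>A. l (c, a) * g a x)\<^sup>2)"
      unfolding L by (intro tendsto_intros l)
  qed
  thus ?thesis by (intro exI[of _ "\<lambda>c a. l (c, a)"]) simp
qed

subsection \<open>Polynomials as functions\<close>

definition monom_val :: "(nat \<Rightarrow> real) \<Rightarrow> (nat \<Rightarrow>\<^sub>0 nat) \<Rightarrow> real"
  where "monom_val x m = (\<Prod>i\<in>Poly_Mapping.keys m. x i ^ Poly_Mapping.lookup m i)"

lemma monom_val_superset:
  assumes "finite A" "Poly_Mapping.keys m \<subseteq> A"
  shows "monom_val x m = (\<Prod>i\<in>A. x i ^ Poly_Mapping.lookup m i)"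
  unfolding monom_val_def using assms
  by (intro prod.mono_neutral_left) (auto simp: in_keys_iff)

lemma monom_val_add: "monom_val x (a + b) = monom_val x a * monom_val x b"
proof -
  let ?A = "Poly_Mapping.keys a \<union> Poly_Mapping.keys b"
  have "monom_val x (a + b) = (\<Prod>i\<in>?A. x i ^ Poly_Mapping.lookup (a + b) i)"
    by (rule monom_val_superset) (auto dest: Poly_Mapping.keys_add[THEN subsetD])
  also have "\<dots> = (\<Prod>i\<in>?A. x i ^ Poly_Mapping.lookup a i) * (\<Prod>i\<in>?A. x i ^ Poly_Mapping.lookup b i)"
    by (simp add: lookup_add power_add prod.distrib)
  also have "\<dots> = monom_val x a * monom_val x b"
    by (simp add: monom_val_superset[of ?A])
  finally show ?thesis .
qed

lemma monom_val_single: "monom_val x (Poly_Mapping.single i r) = x i ^ r"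
  by (cases "r = 0") (auto simp: monom_val_def)

lemma monom_val_0: "monom_val x 0 = 1"
  by (simp add: monom_val_def)

lemma mpoly_eval_superset:
  assumes "finite A" "Poly_Mapping.keys q \<subseteq> A"
  shows "mpoly_eval x q = (\<Sum>m\<in>A. Poly_Mapping.lookup q m * monom_val x m)"
  unfolding mpoly_eval_def monom_val_def using assms
  by (intro sum.mono_neutral_left) (auto simp: in_keys_iff)

lemma mpoly_eval_0: "mpoly_eval x 0 = 0"
  by (simp add: mpoly_eval_def)

lemma mpoly_eval_add: "mpoly_eval x (p + q) = mpoly_eval x p + mpoly_eval x q"
proof -
  let ?A = "Poly_Mapping.keys p \<union> Poly_Mapping.keys q"
  have "mpoly_eval x (p + q) = (\<Sum>m\<in>?A. Poly_Mapping.lookup (p + q) m * monom_val x m)"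
    by (rule mpoly_eval_superset) (auto dest: Poly_Mapping.keys_add[THEN subsetD])
  also have "\<dots> = mpoly_eval x p + mpoly_eval x q"
    by (simp add: mpoly_eval_superset[of ?A] lookup_add distrib_right sum.distrib)
  finally show ?thesis .
qed

lemma mpoly_eval_sum: "mpoly_eval x (sum f A) = (\<Sum>a\<in>A. mpoly_eval x (f a))"
  by (induction A rule: infinite_finite_induct) (auto simp: mpoly_eval_0 mpoly_eval_add)

lemma mpoly_eval_single: "mpoly_eval x (Poly_Mapping.single m a) = a * monom_val x m"
  by (subst mpoly_eval_superset[of "{m}"]) auto

text \<open>Writing a polynomial as the sum of its terms reduces multiplicativity of evaluation to
  products of single terms.\<close>

lemma sum_singles: "(\<Sum>m\<in>Poly_Mapping.keys q. Poly_Mapping.single m (Poly_Mapping.lookup q m)) = q"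
proof (rule poly_mapping_eqI)
  fix k
  show "Poly_Mapping.lookup (\<Sum>m\<in>Poly_Mapping.keys q. Poly_Mapping.single m (Poly_Mapping.lookup q m)) k
      = Poly_Mapping.lookup q k"
    by (auto simp: lookup_sum lookup_single when_def in_keys_iff)
qed

lemma single_times:
  "Poly_Mapping.single k a * q =
    (\<Sum>m\<in>Poly_Mapping.keys q. Poly_Mapping.single (k + m) (a * Poly_Mapping.lookup q m))"
  by (subst sum_singles[of q, symmetric]) (simp add: sum_distrib_left mult_single)

lemma mpoly_eval_single_times:
  "mpoly_eval x (Poly_Mapping.single k a * q) = a * monom_val x k * mpoly_eval x q"
proof -
  have "mpoly_eval x (Poly_Mapping.single k a * q)
    = a * monom_val x k * mpoly_eval x (\<Sum>m\<in>Poly_Mapping.keys q. Poly_Mapping.single m (Poly_Mapping.lookup q m))"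
    unfolding single_times mpoly_eval_sum mpoly_eval_single monom_val_add
    by (simp add: sum_distrib_left mult_ac)
  thus ?thesis by (simp only: sum_singles)
qed

lemma mpoly_eval_mult: "mpoly_eval x (p * q) = mpoly_eval x p * mpoly_eval x q"
proof -
  have "mpoly_eval x ((\<Sum>m\<in>Poly_Mapping.keys p. Poly_Mapping.single m (Poly_Mapping.lookup p m)) * q)
    = mpoly_eval x (\<Sum>m\<in>Poly_Mapping.keys p. Poly_Mapping.single m (Poly_Mapping.lookup p m)) * mpoly_eval x q"
    unfolding mpoly_eval_sum sum_distrib_right mpoly_eval_single_times mpoly_eval_single ..
  thus ?thesis by (simp only: sum_singles)
qed

lemma mpoly_eval_1: "mpoly_eval x 1 = 1"
  using mpoly_eval_single[of x 0 1] by (simp add: monom_val_0)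

lemma mpoly_eval_power: "mpoly_eval x (p ^ k) = mpoly_eval x p ^ k"
  by (induction k) (auto simp: mpoly_eval_1 mpoly_eval_mult)

lemma mpoly_eval_const: "mpoly_eval x (mpoly_const a) = a"
  by (simp add: mpoly_const_def mpoly_eval_single monom_val_0)

lemma mpoly_eval_var: "mpoly_eval x (mpoly_var i) = x i"
  by (simp add: mpoly_var_def mpoly_eval_single monom_val_single)

lemma mpoly_eval_prod_mset: "mpoly_eval x (\<Prod>r\<in>#L. f r) = (\<Prod>r\<in>#L. mpoly_eval x (f r))"
  by (induction L) (auto simp: mpoly_eval_1 mpoly_eval_mult)

lemma mpoly_eval_sum_list: "mpoly_eval x (\<Sum>q\<leftarrow>qs. f q) = (\<Sum>q\<leftarrow>qs. mpoly_eval x (f q))"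
  by (induction qs) (auto simp: mpoly_eval_0 mpoly_eval_add)

section \<open>Injectivity of polynomial evaluation\<close>

text \<open>Uniqueness of base \<open>B\<close> digits: reduction modulo \<open>B\<close> isolates
  the lowest digit, and induction handles the rest.\<close>

lemma digits_inj:
  fixes a b :: "nat \<Rightarrow> nat"
  assumes "\<And>i. i < n \<Longrightarrow> a i < B" "\<And>i. i < n \<Longrightarrow> b i < B"
    and "(\<Sum>i<n. a i * B ^ i) = (\<Sum>i<n. b i * B ^ i)" and "i < n"
  shows "a i = b i"
  using assms
proof (induction n arbitrary: a b i)
  case (Suc n)
  have shift: "(\<Sum>i<Suc n. c i * B ^ i) = c 0 + B * (\<Sum>i<n. c (Suc i) * B ^ i)" for c :: "nat \<Rightarrow> nat"
    by (simp only: sum.lessThan_Suc_shift sum_distrib_left power_Suc power_0 mult_1_right mult_ac)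
  have eq: "a 0 + B * (\<Sum>i<n. a (Suc i) * B ^ i) = b 0 + B * (\<Sum>i<n. b (Suc i) * B ^ i)"
    using Suc.prems(3) by (simp only: shift)
  have lt: "a 0 < B" "b 0 < B" using Suc.prems(1,2) by auto
  have "(a 0 + B * (\<Sum>i<n. a (Suc i) * B ^ i)) mod B = (b 0 + B * (\<Sum>i<n. b (Suc i) * B ^ i)) mod B"
    by (simp only: eq)
  hence 0: "a 0 = b 0" using lt by simp
  with eq lt have "(\<Sum>i<n. a (Suc i) * B ^ i) = (\<Sum>i<n. b (Suc i) * B ^ i)" by simp
  hence "a (Suc j) = b (Suc j)" if "j < n" for j
    using Suc.IH[of "\<lambda>i. a (Suc i)" "\<lambda>i. b (Suc i)" j] Suc.prems(1,2) that by auto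
  with 0 Suc.prems(4) show ?case by (cases i) auto
qed simp

text \<open>
  Kronecker substitution: putting \<open>x\<^sub>i = t\<^bsup>B^i\<^esup>\<close> with \<open>B\<close> larger than all exponents sends
  distinct monomials to distinct powers of \<open>t\<close>.
\<close>
lemma mpoly_eval_eq_0_imp_eq_0:
  assumes "\<And>x. mpoly_eval x q = 0"
  shows "q = 0"
proof (rule ccontr)
  assume "q \<noteq> 0"
  have "finite (\<Union>m\<in>Poly_Mapping.keys q. Poly_Mapping.keys m)" by simp
  then obtain N where N: "(\<Union>m\<in>Poly_Mapping.keys q. Poly_Mapping.keys m) \<subseteq> {..<N}"
    using finite_nat_iff_bounded by blast
  have "finite (\<Union>m\<in>Poly_Mapping.keys q. range (Poly_Mapping.lookup m))"
  proof (intro finite_UN_I)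
    fix m :: "nat \<Rightarrow>\<^sub>0 nat"
    have "range (Poly_Mapping.lookup m) \<subseteq> insert 0 (Poly_Mapping.lookup m ` Poly_Mapping.keys m)"
      by (auto simp: in_keys_iff image_iff)
    thus "finite (range (Poly_Mapping.lookup m))" by (rule finite_subset) simp
  qed simp
  then obtain B where B: "(\<Union>m\<in>Poly_Mapping.keys q. range (Poly_Mapping.lookup m)) \<subseteq> {..<B}"
    using finite_nat_iff_bounded by blast
  \<comment> \<open>The exponent of \<open>t\<close> that the monomial \<open>m\<close> receives;
    the exponents of \<open>m\<close> are its digits in base \<open>B\<close>.\<close>
  define e where "e m = (\<Sum>i<N. Poly_Mapping.lookup m i * B ^ i)" for m
  have e_inj: "m = m'" if "m \<in> Poly_Mapping.keys q" "m' \<in> Poly_Mapping.keys q" "e m = e m'" for m m'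
  proof (rule poly_mapping_eqI)
    fix i
    show "Poly_Mapping.lookup m i = Poly_Mapping.lookup m' i"
    proof (cases "i < N")
      case True
      show ?thesis
        by (rule digits_inj[OF _ _ that(3)[unfolded e_def] True]) (use B that in auto)
    next
      case False
      hence "i \<notin> Poly_Mapping.keys m" "i \<notin> Poly_Mapping.keys m'" using N that by auto
      thus ?thesis by (simp add: in_keys_iff)
    qed
  qed
  define P where "P = (\<Sum>m\<in>Poly_Mapping.keys q. Polynomial.monom (Poly_Mapping.lookup q m) (e m))"
  have "poly P t = mpoly_eval (\<lambda>i. t ^ (B ^ i)) q" for t
  proof -
    have "monom_val (\<lambda>i. t ^ (B ^ i)) m = t ^ e m" if "m \<in> Poly_Mapping.keys q" for m
      using N that by (subst monom_val_superset[of "{..<N}"])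
        (auto simp: e_def power_sum power_mult[symmetric] mult.commute)
    thus ?thesis
      by (simp add: P_def poly_sum poly_monom mpoly_eval_superset[of "Poly_Mapping.keys q"])
  qed
  with assms have "P = 0" by (simp add: poly_all_0_iff_0[symmetric])
  obtain m where m: "m \<in> Poly_Mapping.keys q" using \<open>q \<noteq> 0\<close> by (metis all_not_in_conv keys_eq_empty)
  have "coeff P (e m) = (\<Sum>m'\<in>Poly_Mapping.keys q. if m' = m then Poly_Mapping.lookup q m' else 0)"
    unfolding P_def coeff_sum using e_inj m by (intro sum.cong) auto
  also have "\<dots> = Poly_Mapping.lookup q m" using m by simp
  finally show False using m \<open>P = 0\<close> by (simp add: in_keys_iff)
qed

lemma mpoly_eval_inject:
  assumes "\<And>x. mpoly_eval x p = mpoly_eval x q"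
  shows "p = q"
proof -
  have "mpoly_eval x (p - q) = 0" for x
    using mpoly_eval_add[of x "p - q" q] assms[of x] by simp
  hence "p - q = 0" by (rule mpoly_eval_eq_0_imp_eq_0)
  thus ?thesis by simp
qed


subsection \<open>Linear independence of the power sum products\<close>

lemma lookup_single_times:
  "Poly_Mapping.lookup (Poly_Mapping.single k a * q) m =
    (\<Sum>j\<in>Poly_Mapping.keys q. if k + j = m then a * Poly_Mapping.lookup q j else 0)"
  by (simp add: single_times lookup_sum lookup_single when_def)

lemma lookup_single_times_add:
  fixes k :: "nat \<Rightarrow>\<^sub>0 nat"
  shows "Poly_Mapping.lookup (Poly_Mapping.single k a * q) (k + j) = a * Poly_Mapping.lookup q j"
  by (auto simp: lookup_single_times in_keys_iff)

lemma mpoly_var_power: "mpoly_var i ^ r = Poly_Mapping.single (Poly_Mapping.single i r) 1"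
  by (induction r) (auto simp: mpoly_var_def mult_single single_add[symmetric])

lemma power_sum_part_add_mset:
  "power_sum_part n (add_mset r L) =
    (\<Sum>i<n. Poly_Mapping.single (Poly_Mapping.single i r) 1 * power_sum_part n L)"
  by (simp add: power_sum_part_def power_sum_def mpoly_var_power sum_distrib_right)

text \<open>The partition left when the names of the variables in a monomial are forgotten.\<close>

definition exps :: "(nat \<Rightarrow>\<^sub>0 nat) \<Rightarrow> nat multiset"
  where "exps m = image_mset (Poly_Mapping.lookup m) (mset_set (Poly_Mapping.keys m))"

lemma size_exps: "size (exps m) = card (Poly_Mapping.keys m)"
  by (simp add: exps_def)

lemma keys_single_add:
  fixes m :: "nat \<Rightarrow>\<^sub>0 nat"
  assumes "r > 0"
  shows "Poly_Mapping.keys (Poly_Mapping.single i r + m) = insert i (Poly_Mapping.keys m)"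
  using assms by (auto simp: in_keys_iff lookup_add lookup_single when_def split: if_splits)

lemma exps_single_add:
  assumes "r > 0" "i \<notin> Poly_Mapping.keys m"
  shows "exps (Poly_Mapping.single i r + m) = add_mset r (exps m)"
proof -
  have "Poly_Mapping.lookup (Poly_Mapping.single i r + m) j = Poly_Mapping.lookup m j"
    if "j \<in> Poly_Mapping.keys m" for j
    using that assms(2) by (auto simp: lookup_add lookup_single when_def)
  moreover have "Poly_Mapping.lookup (Poly_Mapping.single i r + m) i = r"
    using assms(2) by (simp add: lookup_add in_keys_iff)
  ultimately show ?thesis
    using assms unfolding exps_def keys_single_add[OF assms(1)]
    by (auto intro!: image_mset_cong)
qed

text \<open>A monomial of the expanded product assigns a variable to each part of \<open>L\<close>.
  Parts given the same variable merge and lower the number of variables; without merging the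
  exponents are exactly \<open>L\<close>. A part 0 would add no variable.\<close>

lemma exps_power_sum_part:
  assumes "m \<in> Poly_Mapping.keys (power_sum_part n L)" "0 \<notin># L"
  shows "size (exps m) \<le> size L \<and> (size (exps m) = size L \<longrightarrow> exps m = L)"
  using assms
proof (induction L arbitrary: m)
  case empty
  thus ?case by (simp add: power_sum_part_def exps_def)
next
  case (add r L)
  have "\<exists>i<n. \<exists>j\<in>Poly_Mapping.keys (power_sum_part n L). m = Poly_Mapping.single i r + j"
  proof (rule ccontr)
    assume neg: "\<not> ?thesis"
    have "Poly_Mapping.lookup (power_sum_part n (add_mset r L)) m = 0"
      unfolding power_sum_part_add_mset lookup_sum lookup_single_times
      using neg by (intro sum.neutral ballI) auto
    thus False using add.prems(1) by (simp add: in_keys_iff)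
  qed
  then obtain i j where ij: "j \<in> Poly_Mapping.keys (power_sum_part n L)" "m = Poly_Mapping.single i r + j"
    by blast
  have r: "r > 0" using add.prems(2) by (cases r) auto
  have IH: "size (exps j) \<le> size L" "size (exps j) = size L \<longrightarrow> exps j = L"
    using add.IH[OF ij(1)] add.prems(2) by auto
  show ?case
  proof (cases "i \<in> Poly_Mapping.keys j")
    case True
    hence "size (exps m) = size (exps j)"
      using keys_single_add[OF r, of i j] by (simp add: size_exps ij(2) insert_absorb)
    thus ?thesis using IH by simp
  next
    case False
    from exps_single_add[OF r this] show ?thesis using IH by (simp add: ij(2))
  qed
qed

text \<open>With at least as many variables as parts, all parts can be given different variables;
  nonnegativity of all coefficients excludes cancellation.\<close>

lemma power_sum_part_coeff_pos:
  assumes "0 \<notin># L" "size L \<le> n"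
  shows "(\<forall>m. 0 \<le> Poly_Mapping.lookup (power_sum_part n L) m) \<and>
    (\<exists>m. 0 < Poly_Mapping.lookup (power_sum_part n L) m \<and> exps m = L)"
  using assms
proof (induction L)
  case empty
  show ?case
    by (auto simp: power_sum_part_def exps_def lookup_one when_def intro!: exI[of _ 0])
next
  case (add r L)
  have r: "r > 0" using add.prems(1) by (cases r) auto
  from add obtain m where nonneg: "\<And>m. 0 \<le> Poly_Mapping.lookup (power_sum_part n L) m"
    and m: "0 < Poly_Mapping.lookup (power_sum_part n L) m" "exps m = L"
    by auto
  have summand: "0 \<le> Poly_Mapping.lookup (Poly_Mapping.single (Poly_Mapping.single i r) 1 * power_sum_part n L) k"
    for i k
    unfolding lookup_single_times using nonneg by (intro sum_nonneg) auto
  have "card (Poly_Mapping.keys m) < n" using m(2) add.prems(2) by (simp add: size_exps[symmetric])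
  then obtain i where i: "i < n" "i \<notin> Poly_Mapping.keys m"
    by (metis card_lessThan card_mono finite_keys leD lessThan_iff subsetI)
  let ?m = "Poly_Mapping.single i r + m"
  have "0 < Poly_Mapping.lookup (power_sum_part n (add_mset r L)) ?m"
    unfolding power_sum_part_add_mset lookup_sum
    by (rule sum_pos2[of _ i]) (use i m(1) summand in \<open>auto simp: lookup_single_times_add\<close>)
  moreover have "exps ?m = add_mset r L" using exps_single_add[OF r i(2)] m(2) by simp
  moreover have "0 \<le> Poly_Mapping.lookup (power_sum_part n (add_mset r L)) k" for k
    unfolding power_sum_part_add_mset lookup_sum by (intro sum_nonneg summand)
  ultimately show ?case by blast
qed

text \<open>
  A monomial whose exponents form a longest partition \<open>L\<close> in the support of \<open>c\<close> occurs in no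
  other \<open>power_sum_part n M\<close> with \<open>c M \<noteq> 0\<close>.
\<close>
lemma sym_form_eq_0_imp:
  assumes "sym_form n d c = 0" "2 * d \<le> n" "L \<in> partitions_of (2 * d)"
  shows "c L = 0"
proof (rule ccontr)
  assume "c L \<noteq> 0"
  define S where "S = {L \<in> partitions_of (2 * d). c L \<noteq> 0}"
  have "finite S" "S \<noteq> {}" using finite_partitions_of assms(3) \<open>c L \<noteq> 0\<close> by (auto simp: S_def)
  then obtain M where M: "M \<in> S" "\<And>K. K \<in> S \<Longrightarrow> size K \<le> size M"
    using Max_in[of "size ` S"] Max_ge[of "size ` S"] by fastforce
  have M': "0 \<notin># M" "size M \<le> n"
    using M(1) size_le_sum_mset[of M] assms(2) by (auto simp: S_def partitions_of_def)
  obtain m where m: "0 < Poly_Mapping.lookup (power_sum_part n M) m" "exps m = M"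
    using power_sum_part_coeff_pos[OF M'] by blast
  have other: "c K * Poly_Mapping.lookup (power_sum_part n K) m = 0"
    if "K \<in> partitions_of (2 * d)" "K \<noteq> M" for K
  proof (rule ccontr)
    assume "\<not> ?thesis"
    hence K: "K \<in> S" "m \<in> Poly_Mapping.keys (power_sum_part n K)"
      using that by (auto simp: S_def in_keys_iff)
    have "0 \<notin># K" using that by (simp add: partitions_of_def)
    \<comment> \<open>Since \<open>m\<close> occurs in the product for \<open>K\<close>,
      \<open>size M \<le> size K\<close>; maximality gives equality, and then \<open>exps m\<close>
      is both \<open>K\<close> and \<open>M\<close>.\<close>
    from exps_power_sum_part[OF K(2) this] M(2)[OF K(1)] m(2) that(2) show False by auto
  qed
  have "(\<Sum>K\<in>partitions_of (2 * d) - {M}. c K * Poly_Mapping.lookup (power_sum_part n K) m) = 0"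
    by (rule sum.neutral) (use other in blast)
  hence "c M * Poly_Mapping.lookup (power_sum_part n M) m
      = (\<Sum>K\<in>partitions_of (2 * d). c K * Poly_Mapping.lookup (power_sum_part n K) m)"
    using M(1) finite_partitions_of by (subst sum.remove[of _ M]) (auto simp: S_def)
  also have "\<dots> = Poly_Mapping.lookup (sym_form n d c) m"
    unfolding sym_form_def lookup_sum mpoly_const_def
    by (simp add: lookup_single_times_add[where k = 0, simplified])
  also have "\<dots> = 0" using assms(1) by simp
  finally show False using M(1) m(1) by (simp add: S_def)
qed

subsection \<open>Sums of squares of polynomial functions\<close>

text \<open>Squares are treated as functions, since scaling the variables or setting some to zero
  then acts on arguments; injectivity of evaluation leads back to polynomials.\<close>

definition polyfun :: "nat \<Rightarrow> ((nat \<Rightarrow> real) \<Rightarrow> real) set"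
  where "polyfun n = (\<lambda>q x. mpoly_eval x q) ` mpolys n"

lemma polyfunI: "q \<in> mpolys n \<Longrightarrow> (\<And>x. f x = mpoly_eval x q) \<Longrightarrow> f \<in> polyfun n"
  by (auto simp: polyfun_def)

lemma polyfun_monom:
  assumes "Poly_Mapping.keys m \<subseteq> {..<n}"
  shows "(\<lambda>x. a * monom_val x m) \<in> polyfun n"
  by (rule polyfunI[of "Poly_Mapping.single m a"])
    (use assms in \<open>auto simp: mpolys_def mpoly_eval_single split: if_splits\<close>)

lemma polyfun_const: "(\<lambda>x. a) \<in> polyfun n"
  using polyfun_monom[of 0 n a] by (simp add: monom_val_0)

lemma polyfun_var: "i < n \<Longrightarrow> (\<lambda>x. x i) \<in> polyfun n"
  using polyfun_monom[of "Poly_Mapping.single i 1" n 1] by (simp add: monom_val_single)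

lemma polyfun_add:
  assumes "f \<in> polyfun n" "g \<in> polyfun n"
  shows "(\<lambda>x. f x + g x) \<in> polyfun n"
proof -
  from assms obtain p q where "p \<in> mpolys n" "q \<in> mpolys n"
    "f = (\<lambda>x. mpoly_eval x p)" "g = (\<lambda>x. mpoly_eval x q)" by (auto simp: polyfun_def)
  thus ?thesis using Poly_Mapping.keys_add[of p q]
    by (intro polyfunI[of "p + q"]) (auto simp: mpolys_def mpoly_eval_add)
qed

lemma polyfun_mult:
  assumes "f \<in> polyfun n" "g \<in> polyfun n"
  shows "(\<lambda>x. f x * g x) \<in> polyfun n"
proof -
  from assms obtain p q where pq: "p \<in> mpolys n" "q \<in> mpolys n"
    "f = (\<lambda>x. mpoly_eval x p)" "g = (\<lambda>x. mpoly_eval x q)" by (auto simp: polyfun_def)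
  have "Poly_Mapping.keys m \<subseteq> {..<n}" if m: "m \<in> Poly_Mapping.keys (p * q)" for m
  proof -
    obtain a b where "m = a + b" "a \<in> Poly_Mapping.keys p" "b \<in> Poly_Mapping.keys q"
      using m Poly_Mapping.keys_mult[of p q] by blast
    thus ?thesis using pq(1,2) Poly_Mapping.keys_add[of a b] by (fastforce simp: mpolys_def)
  qed
  thus ?thesis using pq by (intro polyfunI[of "p * q"]) (auto simp: mpolys_def mpoly_eval_mult)
qed

lemma polyfun_sum: "(\<And>a. a \<in> A \<Longrightarrow> f a \<in> polyfun n) \<Longrightarrow> (\<lambda>x. \<Sum>a\<in>A. f a x) \<in> polyfun n"
  by (induction A rule: infinite_finite_induct) (auto intro: polyfun_const polyfun_add)

lemma polyfun_power: "f \<in> polyfun n \<Longrightarrow> (\<lambda>x. f x ^ k) \<in> polyfun n"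
  by (induction k) (auto intro: polyfun_const polyfun_mult)

lemma polyfun_prod_mset:
  "(\<And>r. f r \<in> polyfun n) \<Longrightarrow> (\<lambda>x. \<Prod>r\<in>#L. f r x) \<in> polyfun n"
  by (induction L) (auto intro: polyfun_const polyfun_mult)

text \<open>Monomials containing a variable of index at least \<open>m\<close> vanish, and the
  others keep their values.\<close>

lemma polyfun_restrict:
  assumes "q \<in> polyfun n"
  shows "(\<lambda>x. q (\<lambda>i. if i < m then x i else 0)) \<in> polyfun m"
proof -
  from assms obtain p where p: "q = (\<lambda>x. mpoly_eval x p)" by (auto simp: polyfun_def)
  let ?K = "{k \<in> Poly_Mapping.keys p. Poly_Mapping.keys k \<subseteq> {..<m}}"
  have "q (\<lambda>i. if i < m then x i else 0) = (\<Sum>k\<in>?K. Poly_Mapping.lookup p k * monom_val x k)" for x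
  proof -
    have "monom_val (\<lambda>i. if i < m then x i else 0) k = 0" if "\<not> Poly_Mapping.keys k \<subseteq> {..<m}" for k
      using that by (auto simp: monom_val_def in_keys_iff prod_zero_iff intro!: bexI)
    moreover have "monom_val (\<lambda>i. if i < m then x i else 0) k = monom_val x k"
      if "Poly_Mapping.keys k \<subseteq> {..<m}" for k
      unfolding monom_val_def using that by (intro prod.cong) auto
    ultimately show ?thesis unfolding p
      by (subst mpoly_eval_superset[OF finite_keys order.refl], intro sum.mono_neutral_cong_right) auto
  qed
  moreover have "(\<lambda>x. \<Sum>k\<in>?K. Poly_Mapping.lookup p k * monom_val x k) \<in> polyfun m"
    by (intro polyfun_sum polyfun_monom) auto
  ultimately show ?thesis by simp
qed

definition sos_fun :: "nat \<Rightarrow> ((nat \<Rightarrow> real) \<Rightarrow> real) \<Rightarrow> bool"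
  where "sos_fun n f \<longleftrightarrow> (\<exists>qs. set qs \<subseteq> polyfun n \<and> (\<forall>x. f x = (\<Sum>q\<leftarrow>qs. (q x)\<^sup>2)))"

text \<open>An identity between values lifts to an identity of polynomials by
  \<open>mpoly_eval_inject\<close>.\<close>

lemma sum_of_squares_iff: "sum_of_squares n f \<longleftrightarrow> sos_fun n (\<lambda>x. mpoly_eval x f)"
proof
  assume "sum_of_squares n f"
  then obtain qs where "set qs \<subseteq> mpolys n" "f = (\<Sum>q\<leftarrow>qs. q ^ 2)"
    by (auto simp: sum_of_squares_def)
  thus "sos_fun n (\<lambda>x. mpoly_eval x f)" unfolding sos_fun_def polyfun_def
    by (intro exI[of _ "map (\<lambda>q x. mpoly_eval x q) qs"])
      (auto simp: mpoly_eval_sum_list mpoly_eval_power o_def)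
next
  assume "sos_fun n (\<lambda>x. mpoly_eval x f)"
  then obtain qs where "set qs \<subseteq> polyfun n" and qs: "\<And>x. mpoly_eval x f = (\<Sum>q\<leftarrow>qs. (q x)\<^sup>2)"
    by (auto simp: sos_fun_def)
  hence "qs \<in> map (\<lambda>q x. mpoly_eval x q) ` lists (mpolys n)"
    by (auto simp: polyfun_def lists_image[symmetric])
  then obtain ps where ps: "set ps \<subseteq> mpolys n" "qs = map (\<lambda>q x. mpoly_eval x q) ps" by auto
  have "f = (\<Sum>q\<leftarrow>ps. q ^ 2)"
    by (rule mpoly_eval_inject) (simp add: qs ps(2) mpoly_eval_sum_list mpoly_eval_power o_def)
  thus "sum_of_squares n f" using ps(1) by (auto simp: sum_of_squares_def)
qed

lemma sos_fun_nonneg: "sos_fun n f \<Longrightarrow> 0 \<le> f x"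
  by (auto simp: sos_fun_def intro!: sum_list_nonneg)

lemma sos_fun_0: "sos_fun n (\<lambda>x. 0)"
  unfolding sos_fun_def by (intro exI[of _ "[]"]) auto

lemma sos_fun_square: "q \<in> polyfun n \<Longrightarrow> sos_fun n (\<lambda>x. (q x)\<^sup>2)"
  unfolding sos_fun_def by (intro exI[of _ "[q]"]) auto

lemma sos_fun_add:
  assumes "sos_fun n f" "sos_fun n g"
  shows "sos_fun n (\<lambda>x. f x + g x)"
proof -
  from assms obtain ps qs where "set ps \<subseteq> polyfun n" "\<And>x. f x = (\<Sum>q\<leftarrow>ps. (q x)\<^sup>2)"
    "set qs \<subseteq> polyfun n" "\<And>x. g x = (\<Sum>q\<leftarrow>qs. (q x)\<^sup>2)"
    by (auto simp: sos_fun_def)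
  thus ?thesis unfolding sos_fun_def by (intro exI[of _ "ps @ qs"]) auto
qed

lemma sos_fun_sum: "(\<And>a. a \<in> A \<Longrightarrow> sos_fun n (f a)) \<Longrightarrow> sos_fun n (\<lambda>x. \<Sum>a\<in>A. f a x)"
  by (induction A rule: infinite_finite_induct) (auto intro: sos_fun_0 sos_fun_add)

lemma sos_fun_scale:
  assumes "sos_fun n f" "0 \<le> a"
  shows "sos_fun n (\<lambda>x. a * f x)"
proof -
  from assms obtain qs where qs: "set qs \<subseteq> polyfun n" "\<And>x. f x = (\<Sum>q\<leftarrow>qs. (q x)\<^sup>2)"
    by (auto simp: sos_fun_def)
  have "set (map (\<lambda>q x. sqrt a * q x) qs) \<subseteq> polyfun n"
    using qs(1) by (auto intro: polyfun_mult polyfun_const)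
  moreover have "a * f x = (\<Sum>q\<leftarrow>map (\<lambda>q x. sqrt a * q x) qs. (q x)\<^sup>2)" for x
    using assms(2) by (simp add: qs(2) o_def power_mult_distrib sum_list_const_mult)
  ultimately show ?thesis unfolding sos_fun_def by blast
qed

lemma sos_fun_restrict:
  assumes "sos_fun n f"
  shows "sos_fun m (\<lambda>x. f (\<lambda>i. if i < m then x i else 0))"
proof -
  from assms obtain qs where qs: "set qs \<subseteq> polyfun n" "\<And>x. f x = (\<Sum>q\<leftarrow>qs. (q x)\<^sup>2)"
    by (auto simp: sos_fun_def)
  have "set (map (\<lambda>q x. q (\<lambda>i. if i < m then x i else 0)) qs) \<subseteq> polyfun m"
    using qs(1) polyfun_restrict[of _ n m] by auto
  thus ?thesis unfolding sos_fun_def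
    by (intro exI[of _ "map (\<lambda>q x. q (\<lambda>i. if i < m then x i else 0)) qs"]) (auto simp: qs(2) o_def)
qed

section \<open>Degree bound for the squares\<close>

definition mdeg :: "(nat \<Rightarrow>\<^sub>0 nat) \<Rightarrow> nat"
  where "mdeg m = (\<Sum>i\<in>Poly_Mapping.keys m. Poly_Mapping.lookup m i)"

definition monoms_le :: "nat \<Rightarrow> nat \<Rightarrow> (nat \<Rightarrow>\<^sub>0 nat) set"
  where "monoms_le n k = {m. Poly_Mapping.keys m \<subseteq> {..<n} \<and> mdeg m \<le> k}"

lemma finite_monoms_le: "finite (monoms_le n k)"
proof (rule finite_imageD)
  show "inj_on Poly_Mapping.lookup (monoms_le n k)" by (auto intro: inj_onI poly_mapping_eqI)
  have "Poly_Mapping.lookup m i \<le> k" if "m \<in> monoms_le n k" for m i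
  proof (cases "i \<in> Poly_Mapping.keys m")
    case True
    have "Poly_Mapping.lookup m i \<le> mdeg m"
      unfolding mdeg_def by (rule member_le_sum) (use True in auto)
    thus ?thesis using that by (simp add: monoms_le_def)
  qed (simp add: in_keys_iff)
  hence "Poly_Mapping.lookup ` monoms_le n k \<subseteq>
      {f. \<forall>i. (i \<in> {..<n} \<longrightarrow> f i \<in> {..k}) \<and> (i \<notin> {..<n} \<longrightarrow> f i = 0)}"
    by (auto simp: monoms_le_def in_keys_iff subset_iff)
  thus "finite (Poly_Mapping.lookup ` monoms_le n k)"
    by (rule finite_subset) (intro finite_set_of_finite_funs; simp)
qed

lemma monom_val_scale: "monom_val (\<lambda>i. t * x i) m = t ^ mdeg m * monom_val x m"
  by (simp add: monom_val_def mdeg_def power_mult_distrib prod.distrib power_sum)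

lemma monom_val_indep:
  assumes "finite A" "\<And>x. (\<Sum>b\<in>A. c b * monom_val x b) = 0" "a \<in> A"
  shows "c a = 0"
proof -
  let ?q = "\<Sum>b\<in>A. Poly_Mapping.single b (c b)"
  have "?q = 0"
    by (rule mpoly_eval_eq_0_imp_eq_0) (simp add: mpoly_eval_sum mpoly_eval_single assms(2))
  hence "Poly_Mapping.lookup ?q a = 0" by simp
  thus ?thesis using assms(1,3) by (simp add: lookup_sum lookup_single when_def)
qed

text \<open>If the degree exceeded \<open>d\<close>, then \<open>p ^ 2\<close> minus the bounding
  monomial would have a positive leading coefficient and be positive for large
  \<open>t\<close>.\<close>

lemma degree_le_if_power_bound:
  fixes p :: "real poly"
  assumes "\<And>t. (poly p t)\<^sup>2 \<le> t ^ (2 * d) * K"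
  shows "degree p \<le> d"
proof (rule ccontr)
  assume neg: "\<not> ?thesis"
  hence "p \<noteq> 0" by auto
  let ?r = "p ^ 2 - Polynomial.monom K (2 * d)"
  have "degree (Polynomial.monom K (2 * d)) < degree (p ^ 2)"
    using neg \<open>p \<noteq> 0\<close> by (intro le_less_trans[OF degree_monom_le]) (simp add: degree_power_eq)
  hence "lead_coeff ?r = lead_coeff (p ^ 2)"
    by (metis add.commute diff_conv_add_uminus degree_minus lead_coeff_add_le)
  moreover have "lead_coeff (p ^ 2) > 0"
    using \<open>p \<noteq> 0\<close> by (simp add: lead_coeff_power)
  ultimately obtain t0 where "\<And>t. t \<ge> t0 \<Longrightarrow> poly ?r t \<ge> lead_coeff ?r" and "lead_coeff ?r > 0"
    using poly_pinfty_gt_lc[of ?r] by auto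
  hence "poly ?r t0 > 0" by force
  thus False using assms[of t0] by (simp add: poly_monom mult.commute)
qed

text \<open>Along the line through \<open>x\<close>, \<open>q\<close> is a polynomial in
  \<open>t\<close> whose coefficients are the values at \<open>x\<close> of the homogeneous
  components of \<open>q\<close>. The growth bound kills those of degree above \<open>d\<close> at
  every \<open>x\<close>, and independence of monomials kills their coefficients.\<close>

lemma polyfun_monoms_le:
  assumes "q \<in> polyfun n" "\<And>x t. (q (\<lambda>i. t * x i))\<^sup>2 \<le> t ^ (2 * d) * K x"
  shows "\<exists>l. \<forall>x. q x = (\<Sum>a\<in>monoms_le n d. l a * monom_val x a)"
proof -
  from assms(1) obtain p where p: "p \<in> mpolys n" "q = (\<lambda>x. mpoly_eval x p)" by (auto simp: polyfun_def)
  have zero: "Poly_Mapping.lookup p m = 0" if "mdeg m > d" for m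
  proof -
    let ?J = "{k \<in> Poly_Mapping.keys p. mdeg k = mdeg m}"
    have "(\<Sum>k\<in>?J. Poly_Mapping.lookup p k * monom_val x k) = 0" for x
    proof -
      define P where "P = (\<Sum>k\<in>Poly_Mapping.keys p.
        Polynomial.monom (Poly_Mapping.lookup p k * monom_val x k) (mdeg k))"
      have "poly P t = q (\<lambda>i. t * x i)" for t
        by (simp add: P_def p(2) poly_sum poly_monom mpoly_eval_superset[OF finite_keys order.refl]
            monom_val_scale mult_ac)
      hence "degree P \<le> d" using assms(2)[of _ x] by (intro degree_le_if_power_bound) auto
      hence "coeff P (mdeg m) = 0" using that by (intro coeff_eq_0) auto
      thus ?thesis by (simp add: P_def coeff_sum sum.inter_filter[symmetric])
    qed
    hence "m \<in> ?J \<Longrightarrow> ?thesis" using monom_val_indep[of ?J "Poly_Mapping.lookup p" m] by auto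
    thus ?thesis by (auto simp: in_keys_iff)
  qed
  hence "Poly_Mapping.keys p \<subseteq> monoms_le n d"
    using p(1) by (auto simp: monoms_le_def mpolys_def in_keys_iff not_le[symmetric])
  thus ?thesis unfolding p(2) using mpoly_eval_superset[OF finite_monoms_le] by blast
qed


subsection \<open>Closed convex cones\<close>

definition psum_val :: "nat \<Rightarrow> nat multiset \<Rightarrow> (nat \<Rightarrow> real) \<Rightarrow> real"
  where "psum_val n L x = (\<Prod>r\<in>#L. \<Sum>i<n. x i ^ r)"

definition sym_val :: "nat \<Rightarrow> nat \<Rightarrow> (nat multiset \<Rightarrow> real) \<Rightarrow> (nat \<Rightarrow> real) \<Rightarrow> real"
  where "sym_val n d c x = (\<Sum>L\<in>partitions_of (2 * d). c L * psum_val n L x)"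

lemma mpoly_eval_sym_form: "mpoly_eval x (sym_form n d c) = sym_val n d c x"
  by (simp add: sym_form_def sym_val_def psum_val_def power_sum_part_def power_sum_def
      mpoly_eval_sum mpoly_eval_mult mpoly_eval_const mpoly_eval_prod_mset mpoly_eval_power mpoly_eval_var)

lemma Sigma_sym_iff: "c \<in> Sigma_sym n d \<longleftrightarrow> c \<in> coeff_space d \<and> sos_fun n (sym_val n d c)"
  by (simp add: Sigma_sym_def sum_of_squares_iff mpoly_eval_sym_form)

lemma P_sym_iff: "c \<in> P_sym n d \<longleftrightarrow> c \<in> coeff_space d \<and> (\<forall>x. 0 \<le> sym_val n d c x)"
  by (simp add: P_sym_def mpoly_eval_sym_form)

lemma Sigma_sym_subset_P_sym: "Sigma_sym n d \<subseteq> P_sym n d"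
  by (auto simp: Sigma_sym_iff P_sym_iff intro: sos_fun_nonneg)

lemma psum_val_union: "psum_val n (L + M) x = psum_val n L x * psum_val n M x"
  by (simp add: psum_val_def)

lemma psum_val_add_mset: "psum_val n (add_mset r L) x = (\<Sum>i<n. x i ^ r) * psum_val n L x"
  by (simp add: psum_val_def)

lemma polyfun_psum_val: "psum_val n L \<in> polyfun n"
  unfolding psum_val_def[abs_def]
  by (intro polyfun_prod_mset polyfun_sum polyfun_power polyfun_var) auto

lemma psum_val_scale: "psum_val n L (\<lambda>i. t * x i) = t ^ sum_mset L * psum_val n L x"
  by (induction L) (simp_all add: psum_val_add_mset power_mult_distrib sum_distrib_left[symmetric]
      power_add psum_val_def)

lemma sym_val_scale: "sym_val n d c (\<lambda>i. t * x i) = t ^ (2 * d) * sym_val n d c x"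
  by (auto simp: sym_val_def psum_val_scale sum_distrib_left partitions_of_def intro!: sum.cong)

text \<open>Positive powers of the variables set to zero drop out. A part 0 is excluded because
  \<open>0 ^ 0 = 1\<close> would still count them.\<close>

lemma psum_val_restrict:
  assumes "m \<le> n" "0 \<notin># L"
  shows "psum_val n L (\<lambda>i. if i < m then x i else 0) = psum_val m L x"
  using assms(2)
proof (induction L)
  case (add r L)
  have "(\<Sum>i<n. (if i < m then x i else 0) ^ r) = (\<Sum>i<m. x i ^ r)"
    using assms(1) add.prems by (intro sum.mono_neutral_cong_right) (auto simp: zero_power)
  thus ?case using add by (simp add: psum_val_add_mset)
qed (simp add: psum_val_def)

lemma sym_val_restrict:
  assumes "m \<le> n"
  shows "sym_val n d c (\<lambda>i. if i < m then x i else 0) = sym_val m d c x"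
  unfolding sym_val_def by (intro sum.cong) (auto simp: partitions_of_def psum_val_restrict[OF assms])

lemma sym_val_0: "sym_val n d 0 x = 0"
  by (simp add: sym_val_def)

lemma sym_val_add: "sym_val n d (b + c) x = sym_val n d b x + sym_val n d c x"
  by (simp add: sym_val_def distrib_right sum.distrib)

lemma sym_val_scaleR: "sym_val n d (a *\<^sub>R c) x = a * sym_val n d c x"
  by (simp add: sym_val_def scaleR_fun_def sum_distrib_left mult.assoc)

text \<open>Setting the variables of index at least \<open>m\<close> to zero preserves sums of
  squares and keeps the coefficient vector.\<close>

lemma Sigma_sym_antimono: "m \<le> n \<Longrightarrow> Sigma_sym n d \<subseteq> Sigma_sym m d"
  using sos_fun_restrict[of n "sym_val n d _" m] by (auto simp: Sigma_sym_iff sym_val_restrict)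

lemma P_sym_antimono:
  assumes "m \<le> n"
  shows "P_sym n d \<subseteq> P_sym m d"
proof
  fix c assume c: "c \<in> P_sym n d"
  hence "0 \<le> sym_val n d c (\<lambda>i. if i < m then x i else 0)" for x by (simp only: P_sym_iff)
  thus "c \<in> P_sym m d" using c by (simp add: P_sym_iff sym_val_restrict[OF assms])
qed

lemma coeff_space_0: "0 \<in> coeff_space d"
  by (simp add: coeff_space_def)

lemma coeff_space_add: "b \<in> coeff_space d \<Longrightarrow> c \<in> coeff_space d \<Longrightarrow> b + c \<in> coeff_space d"
  by (simp add: coeff_space_def)

lemma coeff_space_scaleR: "c \<in> coeff_space d \<Longrightarrow> a *\<^sub>R c \<in> coeff_space d"
  by (simp add: coeff_space_def scaleR_fun_def)

lemma convex_cone_Sigma_sym: "convex_cone (Sigma_sym n d)"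
proof -
  have "sos_fun n (sym_val n d 0)" using sos_fun_0 by (simp add: sym_val_0[abs_def])
  thus ?thesis unfolding convex_cone_iff
    by (auto simp: Sigma_sym_iff coeff_space_0 coeff_space_add coeff_space_scaleR
        sym_val_add[abs_def] sym_val_scaleR[abs_def] intro: sos_fun_add sos_fun_scale)
qed

lemma convex_cone_P_sym: "convex_cone (P_sym n d)"
  unfolding convex_cone_iff
  by (auto simp: P_sym_iff coeff_space_0 coeff_space_add coeff_space_scaleR sym_val_0
      sym_val_add sym_val_scaleR)

lemma convex_cone_INT: "(\<And>i. i \<in> I \<Longrightarrow> convex_cone (S i)) \<Longrightarrow> convex_cone (\<Inter>i\<in>I. S i)"
  by (auto simp: convex_cone_iff)

text \<open>A multiset is coded by a chosen list of its elements. Countability of the index type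
  makes the function space first countable, so closedness can be tested on sequences.\<close>

instance multiset :: (countable) countable
  by (rule countable_classI[of "\<lambda>M. to_nat (SOME xs. mset xs = M)"])
    (metis (mono_tags, lifting) ex_mset someI_ex from_nat_to_nat)

lemma tendsto_fun_apply:
  assumes "(s \<longlongrightarrow> c) F"
  shows "((\<lambda>k. s k i) \<longlongrightarrow> c i) F"
  using continuous_on_tendsto_compose[OF continuous_on_product_coordinates assms] by simp

lemma tendsto_sym_val:
  "(s \<longlongrightarrow> c) F \<Longrightarrow> ((\<lambda>k. sym_val n d (s k) x) \<longlongrightarrow> sym_val n d c x) F"
  unfolding sym_val_def by (intro tendsto_sum tendsto_mult_right tendsto_fun_apply[where s = s])

lemma coeff_space_limit:
  assumes "\<And>k. s k \<in> coeff_space d" "s \<longlonglongrightarrow> c"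
  shows "c \<in> coeff_space d"
proof -
  have "c L = 0" if "L \<notin> partitions_of (2 * d)" for L
  proof -
    have "(\<lambda>k. s k L) \<longlonglongrightarrow> c L" by (rule tendsto_fun_apply[OF assms(2)])
    moreover have "(\<lambda>k. s k L) = (\<lambda>k. 0)" using assms(1) that by (simp add: coeff_space_def)
    ultimately show ?thesis by (simp add: LIMSEQ_const_iff)
  qed
  thus ?thesis by (simp add: coeff_space_def)
qed

section \<open>Closedness for a fixed number of variables\<close>

lemma closed_P_sym: "closed (P_sym n d)"
  unfolding closed_sequential_limits
proof (intro allI impI, elim conjE)
  fix s c assume s: "\<forall>k. s k \<in> P_sym n d" "s \<longlonglongrightarrow> c"
  have "0 \<le> sym_val n d c x" for x
    by (rule tendsto_lowerbound[OF tendsto_sym_val[OF s(2)]]) (use s(1) in \<open>auto simp: P_sym_iff\<close>)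
  moreover have "c \<in> coeff_space d"
    by (rule coeff_space_limit[OF _ s(2)]) (use s(1) in \<open>auto simp: P_sym_iff\<close>)
  ultimately show "c \<in> P_sym n d" by (simp add: P_sym_iff)
qed

text \<open>Each square is at most the whole form, which is homogeneous of degree
  \<open>2 * d\<close>, so every summand is the square of a polynomial in one finite-dimensional
  space depending only on \<open>n\<close> and \<open>d\<close>.\<close>

lemma sos_sym_val_monoms_le:
  assumes "sos_fun n (sym_val n d c)"
  shows "\<exists>ls. \<forall>x. sym_val n d c x = (\<Sum>l\<leftarrow>ls. (\<Sum>a\<in>monoms_le n d. l a * monom_val x a)\<^sup>2)"
proof -
  from assms obtain qs where qs: "set qs \<subseteq> polyfun n"
    "\<And>x. sym_val n d c x = (\<Sum>q\<leftarrow>qs. (q x)\<^sup>2)"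
    by (auto simp: sos_fun_def)
  have "\<exists>l. \<forall>x. q x = (\<Sum>a\<in>monoms_le n d. l a * monom_val x a)" if "q \<in> set qs" for q
  proof (rule polyfun_monoms_le)
    show "q \<in> polyfun n" using qs(1) that by auto
    fix x t
    have "(q (\<lambda>i. t * x i))\<^sup>2 \<le> sym_val n d c (\<lambda>i. t * x i)"
      unfolding qs(2) by (rule member_le_sum_list) (use that in auto)
    thus "(q (\<lambda>i. t * x i))\<^sup>2 \<le> t ^ (2 * d) * sym_val n d c x" by (simp only: sym_val_scale)
  qed
  then obtain l where l: "\<And>q x. q \<in> set qs \<Longrightarrow> q x = (\<Sum>a\<in>monoms_le n d. l q a * monom_val x a)"
    by metis
  have "sym_val n d c x = (\<Sum>l\<leftarrow>map l qs. (\<Sum>a\<in>monoms_le n d. l a * monom_val x a)\<^sup>2)" for x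
    unfolding qs(2) by (simp add: o_def) (intro arg_cong[where f = sum_list] map_cong refl, simp add: l)
  thus ?thesis by blast
qed

text \<open>\<open>limit_of_sums_of_squares\<close> applies to the finite independent family of
  monomials of degree at most \<open>d\<close>, since the values of the forms converge
  pointwise.\<close>

lemma closed_Sigma_sym: "closed (Sigma_sym n d)"
  unfolding closed_sequential_limits
proof (intro allI impI, elim conjE)
  fix s c assume s: "\<forall>k. s k \<in> Sigma_sym n d" "s \<longlonglongrightarrow> c"
  let ?A = "monoms_le n d"
  have "\<forall>k. \<exists>ls. \<forall>x. sym_val n d (s k) x = (\<Sum>l\<leftarrow>ls. (\<Sum>a\<in>?A. l a * monom_val x a)\<^sup>2)"
    using s(1) sos_sym_val_monoms_le by (auto simp: Sigma_sym_iff)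
  from choice[OF this] obtain ls where
    ls: "\<forall>k x. sym_val n d (s k) x = (\<Sum>l\<leftarrow>ls k. (\<Sum>a\<in>?A. l a * monom_val x a)\<^sup>2)" ..
  have "\<exists>L. \<forall>x. sym_val n d c x = (\<Sum>e\<in>?A. (\<Sum>a\<in>?A. L e a * monom_val x a)\<^sup>2)"
  proof (rule limit_of_sums_of_squares[where qs = ls and g = "\<lambda>a x. monom_val x a", OF finite_monoms_le])
    show "(\<lambda>k. \<Sum>q\<leftarrow>ls k. (\<Sum>a\<in>?A. q a * monom_val x a)\<^sup>2) \<longlonglongrightarrow> sym_val n d c x" for x
      using tendsto_sym_val[OF s(2), of n d x] by (simp only: ls)
  qed (rule monom_val_indep[OF finite_monoms_le])
  then obtain L where L: "\<And>x. sym_val n d c x = (\<Sum>e\<in>?A. (\<Sum>a\<in>?A. L e a * monom_val x a)\<^sup>2)"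
    by blast
  have "sos_fun n (\<lambda>x. \<Sum>e\<in>?A. (\<Sum>a\<in>?A. L e a * monom_val x a)\<^sup>2)"
    by (intro sos_fun_sum sos_fun_square polyfun_sum polyfun_monom) (simp add: monoms_le_def)
  moreover have "c \<in> coeff_space d"
    by (rule coeff_space_limit[OF _ s(2)]) (use s(1) in \<open>auto simp: Sigma_sym_iff\<close>)
  ultimately show "c \<in> Sigma_sym n d" by (simp add: Sigma_sym_iff L[abs_def])
qed

section \<open>Kuratowski limits of decreasing closed sets\<close>

text \<open>Constant sequences put the intersection into the lower limit. Conversely, a sequence
  along a subsequence of the sets eventually lies in each closed \<open>A n\<close>, hence so does
  its limit.\<close>

lemma kuratowski_limit_decreasing:
  assumes closed: "\<And>n. N \<le> n \<Longrightarrow> closed (A n)"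
    and antimono: "\<And>m n. N \<le> m \<Longrightarrow> m \<le> n \<Longrightarrow> A n \<subseteq> A m"
  shows "kuratowski_limit A (\<Inter>n\<in>{N..}. A n)"
proof -
  have "(\<Inter>n\<in>{N..}. A n) \<subseteq> kuratowski_liminf A"
    unfolding kuratowski_liminf_def
    by (auto intro!: exI[of _ "\<lambda>_. _"] eventually_sequentiallyI[of N])
  moreover have "kuratowski_liminf A \<subseteq> kuratowski_limsup A"
  proof
    fix a assume "a \<in> kuratowski_liminf A"
    then obtain s M where s: "\<And>n. M \<le> n \<Longrightarrow> s n \<in> A n" "s \<longlonglongrightarrow> a"
      by (auto simp: kuratowski_liminf_def eventually_sequentially)
    have "strict_mono (\<lambda>k. k + M)" by (simp add: strict_mono_def)
    with s show "a \<in> kuratowski_limsup A"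
      unfolding kuratowski_limsup_def using LIMSEQ_ignore_initial_segment[OF s(2), of M]
      by (auto intro!: exI[of _ "\<lambda>k. k + M"] exI[of _ "\<lambda>k. s (k + M)"])
  qed
  moreover have "kuratowski_limsup A \<subseteq> (\<Inter>n\<in>{N..}. A n)"
  proof (intro subsetI INT_I)
    fix a n assume "a \<in> kuratowski_limsup A" and n: "n \<in> {N..}"
    then obtain r s where r: "strict_mono (r :: nat \<Rightarrow> nat)" and s: "\<And>k. s k \<in> A (r k)" "s \<longlonglongrightarrow> a"
      by (auto simp: kuratowski_limsup_def)
    \<comment> \<open>A strictly increasing \<open>r\<close> satisfies
      \<open>r (k + n) \<ge> k + n\<close>, so shifting by \<open>n\<close> reaches sets contained
      in \<open>A n\<close>.\<close>
    have "s (k + n) \<in> A n" for k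
      using s(1)[of "k + n"] antimono[of n "r (k + n)"] seq_suble[OF r, of "k + n"] n by auto
    moreover have "(\<lambda>k. s (k + n)) \<longlonglongrightarrow> a" by (rule LIMSEQ_ignore_initial_segment[OF s(2)])
    ultimately show "a \<in> A n" using closed_sequentially[OF closed, of n "\<lambda>k. s (k + n)" a] n by simp
  qed
  ultimately show ?thesis by (auto simp: kuratowski_limit_def)
qed


subsection \<open>Interior points and pointedness\<close>

text \<open>Parts are collected greedily until the weight \<open>k\<close> is reached; at most one
  part, the one that overshoots, has to be cut into \<open>s + t\<close>.\<close>

lemma partition_split:
  fixes L :: "nat multiset"
  assumes "0 \<notin># L" "k \<le> sum_mset L"
  shows "(\<exists>M N. L = M + N \<and> sum_mset M = k) \<or>
    (\<exists>M N s t. L = add_mset (s + t) (M + N) \<and> 0 < s \<and> 0 < t \<and> sum_mset M + s = k)"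
  using assms
proof (induction L arbitrary: k)
  case (add r L)
  consider "k = 0" | "0 < k" "k < r" | "r \<le> k" by linarith
  thus ?case
  proof cases
    case 1
    thus ?thesis by (intro disjI1 exI[of _ "{#}"] exI[of _ "add_mset r L"]) auto
  next
    case 2
    thus ?thesis
      by (intro disjI2 exI[of _ "{#}"] exI[of _ L] exI[of _ k] exI[of _ "r - k"]) auto
  next
    case 3
    with add.prems have "k - r \<le> sum_mset L" "0 \<notin># L" by auto
    from add.IH[OF this(2,1)] show ?thesis
    proof (elim disjE exE conjE)
      fix M N assume "L = M + N" "sum_mset M = k - r"
      thus ?thesis using 3 by (intro disjI1 exI[of _ "add_mset r M"] exI[of _ N]) auto
    next
      fix M N s t
      assume "L = add_mset (s + t) (M + N)" "0 < s" "0 < t" "sum_mset M + s = k - r"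
      thus ?thesis using 3
        by (intro disjI2 exI[of _ "add_mset r M"] exI[of _ N] exI[of _ s] exI[of _ t]) auto
    qed
  qed
qed auto

lemma sym_val_indicator:
  "K \<in> partitions_of (2 * d) \<Longrightarrow> sym_val n d (indicator {K}) x = psum_val n K x"
  using finite_partitions_of by (simp add: sym_val_def indicator_def)

text \<open>Completing the square leaves the factor \<open>1 - c\<^sup>2 / 4\<close>, which is
  positive for every \<open>c\<close> of either sign in the allowed range.\<close>

lemma sos_fun_square_cross:
  assumes "f \<in> polyfun n" "g \<in> polyfun n" "\<bar>c\<bar> \<le> 1"
  shows "sos_fun n (\<lambda>x. (f x)\<^sup>2 + (g x)\<^sup>2 + c * (f x * g x))"
proof -
  have "c\<^sup>2 \<le> 1" using assms(3) by (simp add: abs_square_le_1)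
  hence "sos_fun n (\<lambda>x. (f x + c / 2 * g x)\<^sup>2 + (1 - c\<^sup>2 / 4) * (g x)\<^sup>2)"
    by (intro sos_fun_add sos_fun_scale sos_fun_square polyfun_add polyfun_mult polyfun_const assms) auto
  moreover have "(f x + c / 2 * g x)\<^sup>2 + (1 - c\<^sup>2 / 4) * (g x)\<^sup>2 = (f x)\<^sup>2 + (g x)\<^sup>2 + c * (f x * g x)" for x
    by (simp add: power2_eq_square algebra_simps)
  ultimately show ?thesis by simp
qed

text \<open>
  Splitting \<open>L\<close> into two halves of weight \<open>d\<close>, possibly cutting one part \<open>s + t\<close> in two,
  writes \<open>p\<^sub>L\<close> as an inner product \<open>\<Sum>\<^sub>i (x\<^sub>i\<^sup>s p\<^sub>M) (x\<^sub>i\<^sup>t p\<^sub>N)\<close> of forms of degree \<open>d\<close>;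
  the sum of the two squared norms dominates it, uniformly in the number of variables.
\<close>
lemma psum_val_dominated:
  assumes "L \<in> partitions_of (2 * d)"
  shows "\<exists>D \<in> coeff_space d. \<forall>n c. \<bar>c\<bar> \<le> 1 \<longrightarrow> sos_fun n (\<lambda>x. sym_val n d D x + c * psum_val n L x)"
proof -
  have L: "0 \<notin># L" "sum_mset L = 2 * d" using assms by (auto simp: partitions_of_def)
  have mem: "indicator {K} + indicator {K'} \<in> coeff_space d"
    if "K \<in> partitions_of (2 * d)" "K' \<in> partitions_of (2 * d)" for K K'
    using that by (auto simp: coeff_space_def indicator_def)
  have "d \<le> sum_mset L" using L(2) by simp
  from partition_split[OF L(1) this] show ?thesis
  proof (elim disjE exE conjE)
    fix M N assume MN: "L = M + N" "sum_mset M = d"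
    hence p: "M + M \<in> partitions_of (2 * d)" "N + N \<in> partitions_of (2 * d)"
      using L by (auto simp: partitions_of_def)
    have "sos_fun n (\<lambda>x. (psum_val n M x)\<^sup>2 + (psum_val n N x)\<^sup>2 + c * (psum_val n M x * psum_val n N x))"
      if "\<bar>c\<bar> \<le> 1" for n c
      by (intro sos_fun_square_cross polyfun_psum_val that)
    \<comment> \<open>The two squares are the power sum products of \<open>M + M\<close> and
      \<open>N + N\<close>, so the witness is the sum of their unit vectors.\<close>
    thus ?thesis using mem[OF p]
      by (intro bexI[of _ "indicator {M + M} + indicator {N + N}"])
        (auto simp: sym_val_add sym_val_indicator p psum_val_union MN(1) power2_eq_square)
  next
    fix M N s t
    assume MN: "L = add_mset (s + t) (M + N)" "0 < s" "0 < t" "sum_mset M + s = d"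
    \<comment> \<open>Summing the squares of \<open>x i ^ s * psum_val n M x\<close> over
      \<open>i\<close> gives the power sum product of \<open>?K\<close>, and likewise for
      \<open>t\<close>, \<open>N\<close> and \<open>?K'\<close>; both have weight
      \<open>2 * d\<close>.\<close>
    let ?K = "add_mset (s + s) (M + M)" and ?K' = "add_mset (t + t) (N + N)"
    have p: "?K \<in> partitions_of (2 * d)" "?K' \<in> partitions_of (2 * d)"
      using L MN by (auto simp: partitions_of_def)
    have "sos_fun n (\<lambda>x. \<Sum>i<n. (x i ^ s * psum_val n M x)\<^sup>2 + (x i ^ t * psum_val n N x)\<^sup>2
        + c * ((x i ^ s * psum_val n M x) * (x i ^ t * psum_val n N x)))"
      if "\<bar>c\<bar> \<le> 1" for n c
      by (intro sos_fun_sum sos_fun_square_cross polyfun_mult polyfun_power polyfun_var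
          polyfun_psum_val that) auto
    moreover have "(\<Sum>i<n. (x i ^ s * psum_val n M x)\<^sup>2 + (x i ^ t * psum_val n N x)\<^sup>2
        + c * ((x i ^ s * psum_val n M x) * (x i ^ t * psum_val n N x)))
      = sym_val n d (indicator {?K} + indicator {?K'}) x + c * psum_val n L x" for n c x
      unfolding sym_val_add sym_val_indicator[OF p(1)] sym_val_indicator[OF p(2)]
      by (simp add: psum_val_union psum_val_add_mset MN(1)
          power2_eq_square power_add sum.distrib sum_distrib_left sum_distrib_right mult_ac)
    ultimately show ?thesis using mem[OF p]
      by (intro bexI[of _ "indicator {?K} + indicator {?K'}"]) auto
  qed
qed

lemma full_dimensional_S_Sigma: "full_dimensional_in (coeff_space d) (S_Sigma d)"
proof -
  let ?P = "partitions_of (2 * d)"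
  have "\<forall>L\<in>?P. \<exists>D. D \<in> coeff_space d \<and>
      (\<forall>n c. \<bar>c\<bar> \<le> 1 \<longrightarrow> sos_fun n (\<lambda>x. sym_val n d D x + c * psum_val n L x))"
    using psum_val_dominated by (simp add: Bex_def)
  from bchoice[OF this] obtain D where "\<forall>L\<in>?P. D L \<in> coeff_space d \<and>
      (\<forall>n c. \<bar>c\<bar> \<le> 1 \<longrightarrow> sos_fun n (\<lambda>x. sym_val n d (D L) x + c * psum_val n L x))" ..
  then have D: "\<And>L. L \<in> ?P \<Longrightarrow> D L \<in> coeff_space d"
    "\<And>L n c. L \<in> ?P \<Longrightarrow> \<bar>c\<bar> \<le> 1 \<Longrightarrow> sos_fun n (\<lambda>x. sym_val n d (D L) x + c * psum_val n L x)"
    by simp_all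
  \<comment> \<open>The candidate interior point: it contains a dominating form for every partition,
    so each coordinate can be perturbed separately.\<close>
  define E where "E K = (\<Sum>L\<in>?P. D L K)" for K
  have E: "E \<in> coeff_space d" using D(1) by (auto simp: E_def coeff_space_def intro!: sum.neutral)
  have sym_E: "sym_val n d E x = (\<Sum>L\<in>?P. sym_val n d (D L) x)" for n x
    unfolding sym_val_def E_def sum_distrib_right by (rule sum.swap)
  \<comment> \<open>The radius 1 matches the bound on the factor \<open>c\<close> in the domination
    property and is the same for all \<open>n\<close>.\<close>
  let ?U = "\<Inter>L\<in>?P. {c. \<bar>c L - E L\<bar> < 1}"
  have "open ?U"
    by (intro open_INT finite_partitions_of ballI open_Collect_less continuous_intros
        continuous_on_product_coordinates)
  hence "openin (top_of_set (coeff_space d)) (coeff_space d \<inter> ?U)" by (rule openin_open_Int)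
  moreover have "coeff_space d \<inter> ?U \<subseteq> S_Sigma d"
  proof
    fix c assume c: "c \<in> coeff_space d \<inter> ?U"
    have "sos_fun n (sym_val n d c)" for n
    proof -
      have "sos_fun n (\<lambda>x. \<Sum>L\<in>?P. sym_val n d (D L) x + (c L - E L) * psum_val n L x)"
        using c by (intro sos_fun_sum D(2)) auto
      moreover have "(\<Sum>L\<in>?P. sym_val n d (D L) x + (c L - E L) * psum_val n L x) = sym_val n d c x" for x
        unfolding sum.distrib sym_E[symmetric] by (simp add: sym_val_def left_diff_distrib sum_subtractf)
      ultimately show ?thesis by simp
    qed
    thus "c \<in> S_Sigma d" using c by (simp add: S_Sigma_def Sigma_sym_iff)
  qed
  moreover have "E \<in> coeff_space d \<inter> ?U" using E by simp
  ultimately show ?thesis unfolding full_dimensional_in_def interior_of_def by blast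
qed

text \<open>At each point \<open>x\<close> the values along a line in the cone are affine in
  \<open>t\<close> and nonnegative, so the slope is 0. The form of \<open>v\<close> in
  \<open>2 * d\<close> variables thus vanishes, and linear independence gives
  \<open>v = 0\<close>.\<close>

lemma pointed_S_P: "pointed (S_P d)"
  unfolding pointed_def
proof (intro notI, elim exE conjE)
  fix a v :: "nat multiset \<Rightarrow> real"
  assume "v \<noteq> 0" and "range (\<lambda>t. a + t *\<^sub>R v) \<subseteq> S_P d"
  hence line: "a + t *\<^sub>R v \<in> P_sym (2 * d) d" for t by (auto simp: S_P_def)
  have "sym_val (2 * d) d v x = 0" for x
  proof (rule ccontr)
    let ?a = "sym_val (2 * d) d a x" and ?v = "sym_val (2 * d) d v x"
    assume "?v \<noteq> 0"
    \<comment> \<open>The parameter is chosen so that the affine function takes the value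
      -1.\<close>
    moreover have "0 \<le> ?a + (- (?a + 1) / ?v) * ?v"
      using line[of "- (?a + 1) / ?v"] by (simp only: P_sym_iff sym_val_add sym_val_scaleR)
    ultimately show False by simp
  qed
  hence "sym_form (2 * d) d v = 0"
    by (intro mpoly_eval_eq_0_imp_eq_0) (simp add: mpoly_eval_sym_form)
  hence "v L = 0" if "L \<in> partitions_of (2 * d)" for L
    using sym_form_eq_0_imp that by blast
  moreover have "v L = 0" if "L \<notin> partitions_of (2 * d)" for L
    using line[of 0] line[of 1] that by (auto simp: P_sym_iff coeff_space_def)
  ultimately show False using \<open>v \<noteq> 0\<close> by (auto simp: fun_eq_iff)
qed

lemma S_Sigma_subset_S_P: "S_Sigma d \<subseteq> S_P d"
  using Sigma_sym_subset_P_sym by (fastforce simp: S_Sigma_def S_P_def)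

lemma closedin_coeff_space_INT:
  assumes "\<And>n. A n \<subseteq> coeff_space d" "\<And>n. closed (A n)"
  shows "closedin (top_of_set (coeff_space d)) (\<Inter>n\<in>{2 * d..}. A n)"
  using assms by (intro closed_subset closed_INT) auto

theorem theorem3p2:
  fixes d :: nat
  assumes "d \<ge> 1"
  shows "(convex_cone (S_Sigma d) \<and> closedin (top_of_set (coeff_space d)) (S_Sigma d)
            \<and> pointed (S_Sigma d) \<and> full_dimensional_in (coeff_space d) (S_Sigma d))
       \<and> (convex_cone (S_P d) \<and> closedin (top_of_set (coeff_space d)) (S_P d)
            \<and> pointed (S_P d) \<and> full_dimensional_in (coeff_space d) (S_P d))
       \<and> kuratowski_limit (\<lambda>n. Sigma_sym n d) (S_Sigma d)
       \<and> kuratowski_limit (\<lambda>n. P_sym n d) (S_P d)"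
proof (intro conjI)
  show "convex_cone (S_Sigma d)" "convex_cone (S_P d)"
    unfolding S_Sigma_def S_P_def by (intro convex_cone_INT convex_cone_Sigma_sym convex_cone_P_sym)+
  show "closedin (top_of_set (coeff_space d)) (S_Sigma d)"
    unfolding S_Sigma_def by (intro closedin_coeff_space_INT closed_Sigma_sym) (auto simp: Sigma_sym_iff)
  show "closedin (top_of_set (coeff_space d)) (S_P d)"
    unfolding S_P_def by (intro closedin_coeff_space_INT closed_P_sym) (auto simp: P_sym_iff)
  show "pointed (S_P d)" by (rule pointed_S_P)
  \<comment> \<open>A line in the smaller cone would also lie in the larger one; interior points
    pass in the opposite direction.\<close>
  thus "pointed (S_Sigma d)" using S_Sigma_subset_S_P unfolding pointed_def by blast
  show "full_dimensional_in (coeff_space d) (S_Sigma d)" by (rule full_dimensional_S_Sigma)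
  thus "full_dimensional_in (coeff_space d) (S_P d)"
    using interior_of_mono[OF S_Sigma_subset_S_P] unfolding full_dimensional_in_def by fastforce
  show "kuratowski_limit (\<lambda>n. Sigma_sym n d) (S_Sigma d)"
    unfolding S_Sigma_def by (intro kuratowski_limit_decreasing closed_Sigma_sym Sigma_sym_antimono)
  show "kuratowski_limit (\<lambda>n. P_sym n d) (S_P d)"
    unfolding S_P_def by (intro kuratowski_limit_decreasing closed_P_sym P_sym_antimono)
qed

end
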